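(* Let $\mathfrak g$ be a solvable (finite-dimensional, real, not necessarily unimodular) Lie algebra equipped with a Hermitian structure $(J,g)$ such that its commutator $\mathfrak g'=[\mathfrak g,\mathfrak g]$ is complex, i.e. $J\mathfrak g'=\mathfrak g'$. If the holomorphic sectional curvature of the Chern connection of $g$ is constant, i.e. there is $c\in\mathbb R$ with $H(x)=c$ for all nonzero $x\in\mathfrak g$, then $(\mathfrak g,J,g)$ is Chern flat, i.e. the Chern curvature tensor $R$ vanishes identically.
   Context: A Hermitian structure on a real Lie algebra $\mathfrak g$ is a pair $(J,g)$ where $J:\mathfrak g\to\mathfrak g$ is linear with $J^2=-I$ and $[x,y]-[Jx,Jy]+J[Jx,y]+J[x,Jy]=0$ for all $x,y\in\mathfrak g$, and $g=\langle\,,\rangle$ is an inner product on $\mathfrak g$ with $\langle Jx,Jy\rangle=\langle x,y\rangle$. It corresponds to a left-invariant complex structure and Hermitian metric on a Lie group $G$ with Lie algebra $\mathfrak g$. The Chern connection $\nabla$ of $(\mathfrak g,J,g)$ is the Chern connection of this left-invariant Hermitian structure on $G$, restricted to left-invariant vector fields: the unique bilinear map $\nabla:\mathfrak g\times\mathfrak g\to\mathfrak g$, $(x,y)\mapsto\nabla_xy$, with $\langle\nabla_xy,z\rangle+\langle y,\nabla_xz\rangle=0$, $\nabla_x(Jy)=J\nabla_xy$, and whose torsion $T(x,y)=\nabla_xy-\nabla_yx-[x,y]$ (extended complex bilinearly) satisfies $T(X,\overline Y)=0$ for all $X,Y\in\mathfrak g^{1,0}=\{x-\sqrt{-1}Jx\mid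 x\in\mathfrak g\}\subseteq\mathfrak g\otimes\mathbb C$. Its curvature is $R(x,y,z,w)=\langle \nabla_x\nabla_yz-\nabla_y\nabla_xz-\nabla_{[x,y]}z,\,w\rangle$, and its holomorphic sectional curvature is $H(x)=R(x,Jx,Jx,x)/|x|^4$ for $0\neq x\in\mathfrak g$. *)

theory Defs
  imports "HOL-Analysis.Analysis"
begin

definition lie_bracket :: "('a::real_vector \<Rightarrow> 'a \<Rightarrow> 'a) \<Rightarrow> bool" where
  "lie_bracket br \<longleftrightarrow>
     bilinear br \<and> (\<forall>x. br x x = 0) \<and>
     (\<forall>x y z. br x (br y z) + br y (br z x) + br z (br x y) = 0)"

definition commutator :: "('a::real_vector \<Rightarrow> 'a \<Rightarrow> 'a) \<Rightarrow> 'a set \<Rightarrow> 'a set \<Rightarrow> 'a set" where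
  "commutator br A B = span {br x y |x y. x \<in> A \<and> y \<in> B}"

primrec derived_series :: "('a::real_vector \<Rightarrow> 'a \<Rightarrow> 'a) \<Rightarrow> nat \<Rightarrow> 'a set" where
  "derived_series br 0 = UNIV"
| "derived_series br (Suc n) = commutator br (derived_series br n) (derived_series br n)"

definition solvable_lie :: "('a::real_vector \<Rightarrow> 'a \<Rightarrow> 'a) \<Rightarrow> bool" where
  "solvable_lie br \<longleftrightarrow> (\<exists>n. derived_series br n = {0})"

definition inner_product :: "('a::real_vector \<Rightarrow> 'a \<Rightarrow> real) \<Rightarrow> bool" where
  "inner_product g \<longleftrightarrow>
     bilinear g \<and> (\<forall>x y. g x y = g y x) \<and> (\<forall>x. x \<noteq> 0 \<longrightarrow> g x x > 0)"

definition complex_structure ::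
    "('a::real_vector \<Rightarrow> 'a \<Rightarrow> 'a) \<Rightarrow> ('a \<Rightarrow> 'a) \<Rightarrow> bool" where
  "complex_structure br J \<longleftrightarrow>
     linear J \<and> (\<forall>x. J (J x) = - x) \<and>
     (\<forall>x y. br x y - br (J x) (J y) + J (br (J x) y) + J (br x (J y)) = 0)"

definition hermitian_structure ::
    "('a::real_vector \<Rightarrow> 'a \<Rightarrow> 'a) \<Rightarrow> ('a \<Rightarrow> 'a) \<Rightarrow> ('a \<Rightarrow> 'a \<Rightarrow> real) \<Rightarrow> bool" where
  "hermitian_structure br J g \<longleftrightarrow>
     complex_structure br J \<and> inner_product g \<and> (\<forall>x y. g (J x) (J y) = g x y)"

(* The complexification of 'a is modelled on 'a \<times> 'a, the pair (a, b) standing for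
   a + sqrt(-1) b.  The real vector space structure on pairs is the library's. *)

fun complex_conj :: "'a::real_vector \<times> 'a \<Rightarrow> 'a \<times> 'a" where
  "complex_conj (a, b) = (a, - b)"

fun complex_bilinear_ext ::
    "('a::real_vector \<Rightarrow> 'a \<Rightarrow> 'a) \<Rightarrow> 'a \<times> 'a \<Rightarrow> 'a \<times> 'a \<Rightarrow> 'a \<times> 'a" where
  "complex_bilinear_ext T (a, b) (c, d) = (T a c - T b d, T a d + T b c)"

(* x - sqrt(-1) J x *)
definition type_10 :: "('a::real_vector \<Rightarrow> 'a) \<Rightarrow> ('a \<times> 'a) set" where
  "type_10 J = {(x, - J x) |x. True}"

definition torsion ::
    "('a::real_vector \<Rightarrow> 'a \<Rightarrow> 'a) \<Rightarrow> ('a \<Rightarrow> 'a \<Rightarrow> 'a) \<Rightarrow> 'a \<Rightarrow> 'a \<Rightarrow> 'a" where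
  "torsion br D x y = D x y - D y x - br x y"

(* D x y is the covariant derivative of y in direction x.  For a Hermitian structure on a
   finite-dimensional Lie algebra exactly one D satisfies this predicate. *)
definition chern_connection ::
    "('a::real_vector \<Rightarrow> 'a \<Rightarrow> 'a) \<Rightarrow> ('a \<Rightarrow> 'a) \<Rightarrow> ('a \<Rightarrow> 'a \<Rightarrow> real) \<Rightarrow>
     ('a \<Rightarrow> 'a \<Rightarrow> 'a) \<Rightarrow> bool" where
  "chern_connection br J g D \<longleftrightarrow>
     bilinear D \<and>
     (\<forall>x y z. g (D x y) z + g y (D x z) = 0) \<and>
     (\<forall>x y. D x (J y) = J (D x y)) \<and>
     (\<forall>X\<in>type_10 J. \<forall>Y\<in>type_10 J.
        complex_bilinear_ext (torsion br D) X (complex_conj Y) = 0)"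

definition curvature ::
    "('a::real_vector \<Rightarrow> 'a \<Rightarrow> 'a) \<Rightarrow> ('a \<Rightarrow> 'a \<Rightarrow> real) \<Rightarrow> ('a \<Rightarrow> 'a \<Rightarrow> 'a) \<Rightarrow>
     'a \<Rightarrow> 'a \<Rightarrow> 'a \<Rightarrow> 'a \<Rightarrow> real" where
  "curvature br g D x y z w = g (D x (D y z) - D y (D x z) - D (br x y) z) w"

definition holomorphic_sectional_curvature ::
    "('a::real_vector \<Rightarrow> 'a \<Rightarrow> 'a) \<Rightarrow> ('a \<Rightarrow> 'a) \<Rightarrow> ('a \<Rightarrow> 'a \<Rightarrow> real) \<Rightarrow>
     ('a \<Rightarrow> 'a \<Rightarrow> 'a) \<Rightarrow> 'a \<Rightarrow> real" where
  "holomorphic_sectional_curvature br J g D x =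
     curvature br g D x (J x) (J x) x / sqrt (g x x) ^ 4"

end

(* Under x |-> X = x - i J x, the (0,1)-part of the Chern connection is A x y = [x,y] + J[Jx,y], and
   R(X, conj Y) = [A y, A* x] - A*(A y x) - A (A x y).  So constant holomorphic sectional curvature
   reads |A* x x|^2 - |A x x|^2 - 2 <A (A x x) x, x> = 2c |x|^4.  Since W = [g,g] is complex, A takes
   values in W.  A vector orthogonal to W gives c <= 0; as W is nilpotent, it contains a nonzero
   vector that it centralises, which gives c >= 0.  Hence c = 0.

   Polarising in x and z with z in a complex subspace F on which A vanishes, and summing over an
   orthonormal basis of F, shows A z x = 0 and that A x is a normal operator on F.  For x in W this
   operator is also nilpotent, so it vanishes; climbing a central series of W gives A = 0 on W.
   For x orthogonal to W and F = W the remaining operators A x are commuting normal operators on W,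
   and flatness follows. *)

theory Submission
  imports Defs "HOL-Computational_Algebra.Polynomial"
begin

section \<open>Solvable Lie algebras\<close>

definition poly_op :: "('a::real_vector \<Rightarrow> 'a) \<Rightarrow> real poly \<Rightarrow> 'a \<Rightarrow> 'a" where
  "poly_op f p v = (\<Sum>i\<le>degree p. coeff p i *\<^sub>R (f ^^ i) v)"

lemma poly_op_0 [simp]: "poly_op f 0 v = 0"
  by (simp add: poly_op_def)

lemma poly_op_bound: "degree p \<le> n \<Longrightarrow> poly_op f p v = (\<Sum>i\<le>n. coeff p i *\<^sub>R (f ^^ i) v)"
  unfolding poly_op_def by (rule sum.mono_neutral_left) (auto simp: coeff_eq_0)

lemma poly_op_add: "poly_op f (p + q) v = poly_op f p v + poly_op f q v"
  using poly_op_bound[of p "max (degree p) (degree q)" f v]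
    poly_op_bound[of q "max (degree p) (degree q)" f v]
    poly_op_bound[OF degree_add_le_max[of p q], of f v]
  by (simp add: scaleR_add_left sum.distrib)

lemma poly_op_smult: "poly_op f (smult c p) v = c *\<^sub>R poly_op f p v"
  by (simp add: poly_op_bound[OF degree_smult_le] poly_op_def scaleR_sum_right)

lemma poly_op_pCons:
  assumes "linear f"
  shows "poly_op f (pCons a p) v = a *\<^sub>R v + f (poly_op f p v)"
proof -
  have "poly_op f (pCons a p) v = (\<Sum>i\<le>Suc (degree p). coeff (pCons a p) i *\<^sub>R (f ^^ i) v)"
    by (rule poly_op_bound) (rule degree_pCons_le)
  also have "\<dots> = a *\<^sub>R v + (\<Sum>i\<le>degree p. coeff p i *\<^sub>R f ((f ^^ i) v))"
    by (subst sum.atMost_Suc_shift) simp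
  also have "\<dots> = a *\<^sub>R v + f (poly_op f p v)"
    by (simp add: poly_op_def linear_sum[OF assms] linear_cmul[OF assms])
  finally show ?thesis .
qed

lemma poly_op_mult:
  assumes "linear f"
  shows "poly_op f (p * q) v = poly_op f p (poly_op f q v)"
  by (induction p) (simp_all add: poly_op_add poly_op_smult poly_op_pCons[OF assms])

lemma poly_op_mem:
  assumes "linear f" "subspace S" "\<And>x. x \<in> S \<Longrightarrow> f x \<in> S" "v \<in> S"
  shows "poly_op f p v \<in> S"
  by (induction p) (use assms in \<open>auto simp: poly_op_pCons subspace_0 subspace_add subspace_scale\<close>)

lemma linear_poly_op:
  assumes "linear f"
  shows "linear (poly_op f p)"
proof (induction p)
  case 0
  then show ?case by (simp add: linear_iff)
next
  case (pCons a p)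
  then show ?case
    by (auto simp: linear_iff poly_op_pCons[OF assms] linear_add[OF assms] linear_cmul[OF assms]
        algebra_simps)
qed

text \<open>Independent sets have at most \<open>DIM('a)\<close> elements, so some iterate of
  \<open>f\<close> at \<open>v\<close> lies in the span of the earlier ones; this relation is the
  polynomial.\<close>

lemma ex_annihilating_poly_vector:
  fixes f :: "'a::euclidean_space \<Rightarrow> 'a"
  assumes "linear f"
  shows "\<exists>p. p \<noteq> 0 \<and> poly_op f p v = 0"
proof -
  define S where "S m = (\<lambda>i. (f ^^ i) v) ` {..<m}" for m :: nat
  have "\<exists>m. (f ^^ m) v \<in> span (S m)"
  proof (rule ccontr)
    assume "\<not> ?thesis"
    then have *: "(f ^^ m) v \<notin> span (S m)" for m by blast
    have "independent (S m) \<and> card (S m) = m" for m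
    proof (induction m)
      case 0
      then show ?case by (simp add: S_def independent_empty)
    next
      case (Suc m)
      have "S (Suc m) = insert ((f ^^ m) v) (S m)"
        by (auto simp: S_def lessThan_Suc)
      moreover have "(f ^^ m) v \<notin> S m" using * span_superset by blast
      moreover have "finite (S m)" by (simp add: S_def)
      ultimately show ?case using Suc * by (simp add: independent_insert)
    qed
    then show False
      using independent_bound[of "S (Suc DIM('a))"] by simp
  qed
  then obtain m where m: "(f ^^ m) v \<in> span (S m)" by blast
  \<comment> \<open>Bounding coefficients rather than the degree makes \<open>q\<close> the zero
    polynomial when \<open>m\<close> is 0.\<close>
  let ?T = "{poly_op f q v | q. \<forall>i\<ge>m. coeff q i = 0}"
  have "subspace ?T"
    unfolding subspace_def
  proof (safe, goal_cases)
    case 1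
    then show ?case by (rule exI[of _ 0]) simp
  next
    case (2 _ _ q r)
    then show ?case by (intro exI[of _ "q + r"]) (simp add: poly_op_add)
  next
    case (3 c _ q)
    then show ?case by (intro exI[of _ "smult c q"]) (simp add: poly_op_smult)
  qed
  moreover have monom: "poly_op f (monom 1 i) v = (f ^^ i) v" for i
    using sum.delta[of "{..i}" i "\<lambda>_. (f ^^ i) v"]
    by (simp add: poly_op_bound[OF degree_monom_le] if_distrib cong: if_cong)
       (simp add: if_distrib if_distribR sum.delta cong: if_cong)
  have "S m \<subseteq> ?T"
    unfolding S_def by (force simp: monom[symmetric])
  ultimately have "span (S m) \<subseteq> ?T" by (simp add: span_minimal)
  with m obtain q where q: "(f ^^ m) v = poly_op f q v" "\<forall>i\<ge>m. coeff q i = 0" by blast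
  have "coeff (monom 1 m + smult (-1) q) m = 1" using q by simp
  then have "monom 1 m + smult (-1) q \<noteq> 0" by (metis coeff_0 zero_neq_one)
  moreover have "poly_op f (monom 1 m + smult (-1) q) v = 0"
    by (simp only: poly_op_add poly_op_smult monom q(1)) simp
  ultimately show ?thesis by blast
qed

text \<open>Basis vectors are adjoined one at a time: if \<open>p\<close> kills \<open>T\<close> and
  \<open>q\<close> kills the image of \<open>v\<close> under \<open>p\<close>, then
  \<open>q * p\<close> kills both.\<close>

lemma ex_annihilating_poly:
  fixes f :: "'a::euclidean_space \<Rightarrow> 'a"
  assumes "linear f"
  shows "\<exists>p. p \<noteq> 0 \<and> (\<forall>v. poly_op f p v = 0)"
proof -
  have "\<exists>p. p \<noteq> 0 \<and> (\<forall>v\<in>T. poly_op f p v = 0)" if "finite T" for T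
    using that
  proof (induction T)
    case empty
    then show ?case by (rule_tac exI[of _ 1]) simp
  next
    case (insert v T)
    then obtain p where p: "p \<noteq> 0" "\<forall>v\<in>T. poly_op f p v = 0" by blast
    obtain q where q: "q \<noteq> 0" "poly_op f q (poly_op f p v) = 0"
      using ex_annihilating_poly_vector[OF assms] by blast
    have "poly_op f q 0 = 0" using linear_0[OF linear_poly_op[OF assms]] .
    then have "\<forall>u\<in>insert v T. poly_op f (q * p) u = 0"
      using p q by (auto simp: poly_op_mult[OF assms])
    then show ?case using p q by (metis mult_eq_0_iff)
  qed
  from this[OF finite_Basis] obtain p where "p \<noteq> 0" "\<And>b. b \<in> Basis \<Longrightarrow> poly_op f p b = 0"
    by blast
  moreover have "linear (\<lambda>_::'a. 0::'a)" by (simp add: linear_iff)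
  ultimately show ?thesis
    using linear_eq_stdbasis[OF linear_poly_op[OF assms, of p], of "\<lambda>_. 0"]
    by metis
qed

text \<open>On a finite-dimensional quotient \<open>M / K\<close>, a commutator \<open>N = [X, Z]\<close> that commutes with
  \<open>X\<close> is not injective: \<open>[p(X), Z] = p'(X) N\<close>, so injectivity of \<open>N\<close> would make the derivative of
  the minimal polynomial of \<open>X\<close> annihilate \<open>M / K\<close> as well.\<close>

lemma commutator_not_inj_mod:
  fixes X Z N :: "'a::euclidean_space \<Rightarrow> 'a"
  assumes lin: "linear X" "linear Z" "linear N"
    and sub: "subspace M" "subspace K"
    and MX: "\<And>v. v \<in> M \<Longrightarrow> X v \<in> M" and MZ: "\<And>v. v \<in> M \<Longrightarrow> Z v \<in> M"
    and KX: "\<And>v. v \<in> K \<Longrightarrow> X v \<in> K" and KZ: "\<And>v. v \<in> K \<Longrightarrow> Z v \<in> K"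
    and XZ: "\<And>v. v \<in> M \<Longrightarrow> X (Z v) - Z (X v) - N v \<in> K"
    and XN: "\<And>v. v \<in> M \<Longrightarrow> X (N v) - N (X v) \<in> K"
    and strict: "\<not> M \<subseteq> K"
  shows "\<exists>v\<in>M - K. N v \<in> K"
proof (rule ccontr)
  assume "\<not> ?thesis"
  then have inj: "v \<in> K" if "v \<in> M" "N v \<in> K" for v using that by blast
  let ?P = "\<lambda>p. p \<noteq> 0 \<and> (\<forall>v\<in>M. poly_op X p v \<in> K)"
  have "\<exists>p. ?P p" using ex_annihilating_poly[OF lin(1)] subspace_0[OF sub(2)] by auto
  then obtain p where p: "?P p" and min: "\<And>q. ?P q \<Longrightarrow> degree p \<le> degree q"
    using ex_has_least_nat[of ?P _ degree] by metis
  note [simp] = poly_op_pCons[OF lin(1)]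
  have deriv: "poly_op X q (Z v) - Z (poly_op X q v) - N (poly_op X (pderiv q) v) \<in> K"
    if v: "v \<in> M" for q v
  proof (induction q)
    case 0
    then show ?case using sub lin by (simp add: linear_0 subspace_0)
  next
    case (pCons a q)
    let ?P = "poly_op X q v" and ?P' = "poly_op X (pderiv q) v" and ?Q = "poly_op X q (Z v)"
    have M: "?P \<in> M" "?P' \<in> M" using poly_op_mem[OF lin(1) sub(1) MX v] by auto
    \<comment> \<open>The error for \<open>pCons a q\<close> is \<open>X\<close> of the error for
      \<open>q\<close> plus the two commutation errors, and all three lie in
      \<open>K\<close>.\<close>
    have "X (?Q - Z ?P - N ?P') + (X (Z ?P) - Z (X ?P) - N ?P) + (X (N ?P') - N (X ?P')) \<in> K"
      using pCons(2) KX XZ XN M sub(2) by (intro subspace_add) auto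
    then show ?case
      by (simp add: pderiv_pCons poly_op_add linear_add[OF lin(1)] linear_diff[OF lin(1)]
          linear_add[OF lin(2)] linear_add[OF lin(3)] linear_cmul[OF lin(2)] algebra_simps)
  qed
  have "poly_op X (pderiv p) v \<in> K" if v: "v \<in> M" for v
  proof (rule inj)
    show "poly_op X (pderiv p) v \<in> M" using poly_op_mem[OF lin(1) sub(1) MX v] .
    have "poly_op X p (Z v) \<in> K" "Z (poly_op X p v) \<in> K" using p MZ KZ v by auto
    then have "poly_op X p (Z v) - Z (poly_op X p v) - (poly_op X p (Z v) - Z (poly_op X p v)
        - N (poly_op X (pderiv p) v)) \<in> K"
      by (intro subspace_diff[OF sub(2)] deriv v)
    then show "N (poly_op X (pderiv p) v) \<in> K" by simp
  qed
  \<comment> \<open>A nonzero derivative would be an annihilator of smaller degree.\<close>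
  then have "pderiv p = 0"
    using min[of "pderiv p"] degree_pderiv[of p] pderiv_eq_0_iff[of p] by fastforce
  then have "degree p = 0" by (simp add: pderiv_eq_0_iff)
  then obtain a where a: "p = [:a:]" "a \<noteq> 0" using p by (metis degree_eq_zeroE pCons_0_0)
  have "v \<in> K" if "v \<in> M" for v
  proof -
    have "a *\<^sub>R v \<in> K" using p a that lin by (auto simp: linear_0)
    then have "(1/a) *\<^sub>R a *\<^sub>R v \<in> K" using sub(2) subspace_scale by blast
    then show ?thesis using a by simp
  qed
  then show False using strict by blast
qed

section \<open>Ideals, and the nilpotent action of the commutator of a solvable Lie algebra\<close>

locale lie_alg =
  fixes br :: "'a::euclidean_space \<Rightarrow> 'a \<Rightarrow> 'a"
  assumes lie_bracket: "lie_bracket br"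
begin

lemma bilinear_br: "bilinear br"
  using lie_bracket by (simp add: lie_bracket_def)

lemmas br_simps [simp] =
  bilinear_ladd[OF bilinear_br] bilinear_radd[OF bilinear_br]
  bilinear_lsub[OF bilinear_br] bilinear_rsub[OF bilinear_br]
  bilinear_lneg[OF bilinear_br] bilinear_rneg[OF bilinear_br]
  bilinear_lzero[OF bilinear_br] bilinear_rzero[OF bilinear_br]
  bilinear_lmul[OF bilinear_br] bilinear_rmul[OF bilinear_br]

lemma linear_br: "linear (br x)"
  using bilinear_br by (simp add: bilinear_def)

lemma br_self [simp]: "br x x = 0"
  using lie_bracket by (simp add: lie_bracket_def)

lemma br_anti: "br y x = - br x y"
proof -
  have "br (x + y) (x + y) = 0" by (rule br_self)
  then have "br y x + br x y = 0" by (simp del: br_self add: br_self[of x] br_self[of y] add.commute)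
  then show ?thesis by (simp add: eq_neg_iff_add_eq_0)
qed

lemma br_deriv: "br x (br y z) = br (br x y) z + br y (br x z)"
proof -
  have "br x (br y z) + br y (br z x) + br z (br x y) = 0"
    using lie_bracket by (simp add: lie_bracket_def)
  then have "br x (br y z) = - br y (br z x) - br z (br x y)"
    by (simp add: algebra_simps eq_neg_iff_add_eq_0)
  then show ?thesis by (simp add: br_anti[of x z] br_anti[of "br x y" z])
qed

definition ideal :: "'a set \<Rightarrow> bool" where
  "ideal I \<longleftrightarrow> subspace I \<and> (\<forall>x. \<forall>v\<in>I. br x v \<in> I)"

lemma idealD:
  assumes "ideal I"
  shows "subspace I" "v \<in> I \<Longrightarrow> br x v \<in> I" "v \<in> I \<Longrightarrow> br v x \<in> I"
  using assms br_anti[of v x] by (auto simp: ideal_def subspace_neg)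

lemma ideal_UNIV: "ideal UNIV"
  by (simp add: ideal_def)

lemma ideal_zero: "ideal {0}"
  by (simp add: ideal_def)

lemma ideal_commutator:
  assumes "ideal I" "ideal L"
  shows "ideal (commutator br I L)"
  unfolding ideal_def commutator_def
proof (intro conjI allI ballI)
  fix x v assume "v \<in> span {br a b |a b. a \<in> I \<and> b \<in> L}"
  then show "br x v \<in> span {br a b |a b. a \<in> I \<and> b \<in> L}"
  proof (induction rule: span_induct)
    show "subspace {v. br x v \<in> span {br a b |a b. a \<in> I \<and> b \<in> L}}"
      by (auto simp: subspace_def span_zero span_add span_scale)
  next
    fix v assume "v \<in> {br a b |a b. a \<in> I \<and> b \<in> L}"
    then obtain a b where ab: "v = br a b" "a \<in> I" "b \<in> L" by blast
    have "br (br x a) b \<in> span {br a b |a b. a \<in> I \<and> b \<in> L}"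
      "br a (br x b) \<in> span {br a b |a b. a \<in> I \<and> b \<in> L}"
      using ab idealD(2)[OF assms(1)] idealD(2)[OF assms(2)] by (blast intro: span_base)+
    then show "br x v \<in> span {br a b |a b. a \<in> I \<and> b \<in> L}"
      by (simp add: ab br_deriv[of x] span_add)
  qed
qed simp

lemma br_in_commutator: "a \<in> I \<Longrightarrow> b \<in> L \<Longrightarrow> br a b \<in> commutator br I L"
  unfolding commutator_def by (rule span_base) blast

text \<open>Quantifying over all ideals \<open>K \<subset> M\<close> (i.e. over the subquotients of the adjoint
  representation) says that \<open>I\<close> acts strictly triangularly along some chain of ideals.\<close>

definition acts_nilpotently :: "'a set \<Rightarrow> bool" where
  "acts_nilpotently I \<longleftrightarrow>
     (\<forall>K M. ideal K \<longrightarrow> ideal M \<longrightarrow> K \<subset> M \<longrightarrow> (\<exists>v\<in>M - K. \<forall>a\<in>I. br a v \<in> K))"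

text \<open>By the Jacobi identity \<open>br a (br x v)\<close> is \<open>br (br a x) v\<close> plus
  \<open>br x (br a v)\<close>. The first lies in \<open>K\<close> because \<open>br a x\<close> is
  again in \<open>I\<close>, the second because \<open>K\<close> is an ideal.\<close>

lemma ideal_transporter:
  assumes "ideal I" "ideal K" "ideal M"
  shows "ideal {v \<in> M. \<forall>a\<in>I. br a v \<in> K}"
  unfolding ideal_def
proof (intro conjI allI ballI)
  show "subspace {v \<in> M. \<forall>a\<in>I. br a v \<in> K}"
    using idealD(1)[OF assms(2)] idealD(1)[OF assms(3)]
    by (auto simp: subspace_def)
next
  fix x v assume v: "v \<in> {v \<in> M. \<forall>a\<in>I. br a v \<in> K}"
  have "br a (br x v) \<in> K" if "a \<in> I" for a
    unfolding br_deriv[of a x v]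
    using v that idealD(3)[OF assms(1)] idealD(1,2)[OF assms(2)] by (intro subspace_add) auto
  then show "br x v \<in> {v \<in> M. \<forall>a\<in>I. br a v \<in> K}"
    using v idealD(2)[OF assms(3)] by auto
qed

text \<open>The generalised kernel of \<open>br n\<close> modulo \<open>K\<close> is an ideal, so it suffices that \<open>br n\<close> is
  never injective on a nonzero subquotient.\<close>

lemma commutator_nilpotent_mod:
  assumes I: "ideal I" and K: "ideal K" and M: "ideal M"
    and comm: "\<And>a b v. a \<in> I \<Longrightarrow> b \<in> I \<Longrightarrow> v \<in> M \<Longrightarrow> br a (br b v) - br b (br a v) \<in> K"
    and n: "n = br x z" "n \<in> I" and nx: "\<And>v. v \<in> M \<Longrightarrow> br (br x n) v \<in> K"
    and v: "v \<in> M"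
  shows "\<exists>k. (br n ^^ k) v \<in> K"
proof -
  define N where "N = {v \<in> M. \<exists>k. (br n ^^ k) v \<in> K}"
  note K' = idealD[OF K] and M' = idealD[OF M]
  have lin: "linear (br n ^^ k)" for k
    by (induction k) (simp_all add: linear_iff)
  have up: "(br n ^^ (k + j)) v \<in> K" if "(br n ^^ k) v \<in> K" for k j v
    using that by (induction j) (auto simp: K')
  have pow_M: "(br n ^^ k) v \<in> M" if "v \<in> M" for k v
    using that by (induction k) (auto simp: M')
  have pow_comm: "(br n ^^ k) (br b v) - br b ((br n ^^ k) v) \<in> K"
    if "b \<in> I" "v \<in> M" for k b v
  proof (induction k)
    case 0
    then show ?case using K' by (simp add: subspace_0)
  next
    case (Suc k)
    let ?w = "(br n ^^ k) v"
    have "br n ((br n ^^ k) (br b v) - br b ?w) + (br n (br b ?w) - br b (br n ?w)) \<in> K"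
      by (rule subspace_add[OF K'(1) K'(2)[OF Suc] comm[OF n(2) that(1) pow_M[OF that(2)]]])
    then show ?case by (simp add: algebra_simps)
  qed
  have stable: "br y v \<in> N" if "v \<in> N" for y v
  proof -
    from that obtain k where k: "v \<in> M" "(br n ^^ k) v \<in> K" by (auto simp: N_def)
    let ?ny = "br n y"
    have ny: "?ny \<in> I" using idealD(3)[OF I n(2)] .
    \<comment> \<open>Leibniz rule for \<open>(br n)\<^sup>j (br y v)\<close>, where \<open>br n\<close> and \<open>br (br n y)\<close> commute modulo \<open>K\<close>\<close>
    have "\<exists>c. (br n ^^ j) (br y v) - br y ((br n ^^ j) v) - c *\<^sub>R br ?ny ((br n ^^ (j - 1)) v) \<in> K" for j
    proof (induction j)
      case 0
      \<comment> \<open>At \<open>j = 0\<close> the exponent \<open>j - 1\<close> is truncated to 0,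
        and \<open>c = 0\<close> removes the term.\<close>
      show ?case by (rule exI[of _ 0]) (simp add: K' subspace_0)
    next
      case (Suc j)
      then obtain c where c: "(br n ^^ j) (br y v) - br y ((br n ^^ j) v)
        - c *\<^sub>R br ?ny ((br n ^^ (j - 1)) v) \<in> K" (is "?e \<in> K") by blast
      let ?w = "(br n ^^ (j - 1)) v"
      have 1: "br n (br ?ny ?w) - br ?ny (br n ?w) \<in> K" (is "?d \<in> K")
        using comm[OF n(2) ny pow_M[OF k(1)]] .
      have "br n ?e + c *\<^sub>R ?d \<in> K"
        by (rule subspace_add[OF K'(1) K'(2)[OF c] subspace_scale[OF K'(1) 1]])
      moreover have "br n ?e + c *\<^sub>R ?d = (br n ^^ Suc j) (br y v) - br y ((br n ^^ Suc j) v)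
          - br ?ny ((br n ^^ j) v) - c *\<^sub>R br ?ny (br n ?w)"
        by (simp add: br_deriv[of n y] algebra_simps)
      ultimately have 2: "(br n ^^ Suc j) (br y v) - br y ((br n ^^ Suc j) v)
          - br ?ny ((br n ^^ j) v) - c *\<^sub>R br ?ny (br n ?w) \<in> K" by (simp only:)
      show ?case
      proof (cases j)
        case 0
        have "br n (br y v) - br y (br n v) - 1 *\<^sub>R br ?ny v \<in> K"
          by (simp add: br_deriv[of n y] K' subspace_0)
        then show ?thesis using 0 by (intro exI[of _ 1]) simp
      next
        case (Suc i)
        then show ?thesis using 2
          by (intro exI[of _ "1 + c"]) (simp add: algebra_simps)
      qed
    qed
    \<comment> \<open>At exponent \<open>k + 1\<close> both correction terms contain at least
      \<open>k\<close> applications of \<open>br n\<close> to \<open>v\<close>, hence lie in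
      \<open>K\<close>.\<close>
    from this[of "Suc k"] obtain c where
      c: "(br n ^^ Suc k) (br y v) - br y ((br n ^^ Suc k) v) - c *\<^sub>R br ?ny ((br n ^^ k) v) \<in> K"
      (is "?e \<in> K") by auto
    have "br y ((br n ^^ Suc k) v) \<in> K" "c *\<^sub>R br ?ny ((br n ^^ k) v) \<in> K"
      using k up[of k v 1] K' by (auto simp: subspace_scale)
    then have "?e + br y ((br n ^^ Suc k) v) + c *\<^sub>R br ?ny ((br n ^^ k) v) \<in> K"
      using c K' by (intro subspace_add) auto
    then have "(br n ^^ Suc k) (br y v) \<in> K" by simp
    then show ?thesis using k(1) M' unfolding N_def by blast
  qed
  have "subspace N"
    unfolding subspace_def
  proof (intro conjI ballI allI)
    show "0 \<in> N" using K' M' by (auto simp: N_def subspace_0 intro!: exI[of _ 0])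
  next
    fix v w assume "v \<in> N" "w \<in> N"
    then obtain i j where ij: "v \<in> M" "(br n ^^ i) v \<in> K" "w \<in> M" "(br n ^^ j) w \<in> K"
      by (auto simp: N_def)
    have "(br n ^^ (i + j)) (v + w) \<in> K"
      using up[OF ij(2), of j] up[OF ij(4), of i] K'
      by (simp add: linear_add[OF lin] add.commute[of j i] subspace_add)
    then show "v + w \<in> N" using ij M' by (auto simp: N_def subspace_add)
  next
    fix c v assume "v \<in> N"
    then show "c *\<^sub>R v \<in> N"
      using K' M' by (auto simp: N_def linear_cmul[OF lin] subspace_scale intro: exI subspace_scale[OF K'(1)])
  qed
  with stable have N: "ideal N" by (simp add: ideal_def)
  have "M \<subseteq> N"
  proof (rule ccontr)
    assume "\<not> M \<subseteq> N"
    have KN: "w \<in> N" if "w \<in> K" "w \<in> M" for w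
      using that by (auto simp: N_def intro!: exI[of _ 0])
    \<comment> \<open>On \<open>M / N\<close> the operator \<open>br n\<close> is the commutator of
      \<open>br x\<close> and \<open>br z\<close> and commutes with \<open>br x\<close>, so it is
      not injective. Yet whatever \<open>br n\<close> sends into the generalised kernel already lies
      there.\<close>
    have "\<exists>v\<in>M - N. br n v \<in> N"
    proof (rule commutator_not_inj_mod[of "br x" "br z" "br n" M N])
      fix v assume v: "v \<in> M"
      have "br x (br z v) - br z (br x v) - br n v = 0"
        by (simp add: n(1) br_deriv[of x z])
      then show "br x (br z v) - br z (br x v) - br n v \<in> N"
        using idealD(1)[OF N] by (simp add: subspace_0)
      have "br x (br n v) - br n (br x v) = br (br x n) v"
        by (simp add: br_deriv[of x n])
      then show "br x (br n v) - br n (br x v) \<in> N"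
        using nx[OF v] KN M' v by simp
    qed (use \<open>\<not> M \<subseteq> N\<close> idealD[OF N] M' in \<open>auto simp: linear_br\<close>)
    then obtain v k where "v \<in> M - N" "(br n ^^ k) (br n v) \<in> K" by (auto simp: N_def)
    then show False
      using funpow_Suc_right[of k "br n"] by (auto simp: N_def dest!: spec[of _ "Suc k"] simp del: funpow.simps)
  qed
  then show ?thesis using v by (auto simp: N_def)
qed

text \<open>On the vectors of \<open>M\<close> that \<open>I'\<close> sends into \<open>K\<close>,
  the operators from \<open>I\<close> commute modulo \<open>K\<close> and those from
  \<open>S\<close> are nilpotent modulo \<open>K\<close>. A minimal \<open>I\<close>-stable subspace
  strictly above \<open>K\<close> therefore lies in the kernel modulo \<open>K\<close> of each
  generator.\<close>

lemma acts_nilpotently_step: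
  assumes I: "ideal I" and I': "ideal I'" "acts_nilpotently I'" and S: "I = span S"
    and gen: "\<And>n. n \<in> S \<Longrightarrow> \<exists>x z. n = br x z \<and> br x n \<in> I'"
    and II: "\<And>a b. a \<in> I \<Longrightarrow> b \<in> I \<Longrightarrow> br a b \<in> I'"
  shows "acts_nilpotently I"
  unfolding acts_nilpotently_def
proof (intro allI impI)
  fix K M assume K: "ideal K" and M: "ideal M" and KM: "K \<subset> M"
  note K' = idealD[OF K]
  define M' where "M' = {v \<in> M. \<forall>a\<in>I'. br a v \<in> K}"
  have M': "ideal M'" unfolding M'_def by (rule ideal_transporter[OF I'(1) K M])
  have comm: "br a (br b v) - br b (br a v) \<in> K" if "a \<in> I" "b \<in> I" "v \<in> M'" for a b v
    using II[OF that(1,2)] that(3) by (simp add: M'_def br_deriv[of a b])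
  have nilp: "\<exists>k. (br n ^^ k) v \<in> K" if "n \<in> S" "v \<in> M'" for n v
  proof -
    obtain x z where "n = br x z" "br x n \<in> I'" using gen \<open>n \<in> S\<close> by blast
    then show ?thesis
      using commutator_nilpotent_mod[OF I K M' comm, of n x z v] that
      by (auto simp: M'_def S span_base)
  qed
  \<comment> \<open>Stability is asked under \<open>I\<close> only: the kernel modulo
    \<open>K\<close> of one generator inherits it by commutation.\<close>
  define \<H> where "\<H> = {H. subspace H \<and> K \<subset> H \<and> H \<subseteq> M' \<and> (\<forall>a\<in>I. \<forall>v\<in>H. br a v \<in> H)}"
  have "M' \<in> \<H>"
  proof -
    have "K \<subseteq> M'" using KM K' by (auto simp: M'_def)
    moreover obtain v where "v \<in> M - K" "\<forall>a\<in>I'. br a v \<in> K"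
      using I'(2) K M KM unfolding acts_nilpotently_def by blast
    ultimately show ?thesis
      using idealD[OF M'] by (auto simp: \<H>_def M'_def)
  qed
  then obtain H where H: "H \<in> \<H>" and min: "\<And>H'. H' \<in> \<H> \<Longrightarrow> dim H \<le> dim H'"
    using ex_has_least_nat[of "\<lambda>H. H \<in> \<H>" M' dim] by blast
  have HK: "br n v \<in> K" if n: "n \<in> S" and v: "v \<in> H" for n v
  proof -
    let ?H = "{v \<in> H. br n v \<in> K}"
    have sub: "subspace ?H"
      using H K' by (auto simp: subspace_def \<H>_def)
    obtain w where w: "w \<in> H" "w \<notin> K" using H by (auto simp: \<H>_def)
    have nI: "n \<in> I" using n S by (simp add: span_base)
    obtain k where "(br n ^^ k) w \<in> K" using nilp[OF n, of w] w H by (auto simp: \<H>_def)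
    \<comment> \<open>The last iterate outside \<open>K\<close> shows that the kernel of
      \<open>br n\<close> modulo \<open>K\<close> is strictly larger than \<open>K\<close>.\<close>
    then obtain j where j: "(br n ^^ j) w \<notin> K" "(br n ^^ Suc j) w \<in> K"
      using w by (induction k) auto
    have "(br n ^^ i) w \<in> H" for i
      using w H nI by (induction i) (auto simp: \<H>_def)
    then have "(br n ^^ j) w \<in> ?H" using j by simp
    then have "K \<subset> ?H" using H K' j by (auto simp: \<H>_def)
    moreover have "br a v \<in> ?H" if "a \<in> I" "v \<in> ?H" for a v
    proof -
      have "br n (br a v) - br a (br n v) \<in> K" "br a (br n v) \<in> K"
        using comm[OF nI that(1)] that(2) H K' by (auto simp: \<H>_def)
      then have "(br n (br a v) - br a (br n v)) + br a (br n v) \<in> K"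
        using K' by (blast intro: subspace_add)
      then show ?thesis using that H by (auto simp: \<H>_def)
    qed
    ultimately have "?H \<in> \<H>" using H sub by (auto simp: \<H>_def)
    then have "dim H \<le> dim ?H" by (rule min)
    then have "?H = H"
      using subspace_dim_equal[OF sub, of H] H by (auto simp: \<H>_def)
    then show ?thesis using v by blast
  qed
  obtain v where v: "v \<in> H" "v \<notin> K" using H by (auto simp: \<H>_def)
  have "br a v \<in> K" if "a \<in> I" for a
    using that unfolding S
  proof (induction rule: span_induct)
    show "subspace {a. br a v \<in> K}"
      using K' by (auto simp: subspace_def)
  qed (use HK v in auto)
  moreover have "v \<in> M" using v H by (auto simp: \<H>_def M'_def)
  ultimately show "\<exists>v\<in>M - K. \<forall>a\<in>I. br a v \<in> K" using v by blast
qed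

lemma ideal_derived_series: "ideal (derived_series br k)"
  by (induction k) (auto simp: ideal_UNIV ideal_commutator)

text \<open>Going down the derived series from its end, the intermediate ideal \<open>[UNIV, D k]\<close> makes every
  generator a commutator that commutes with one of its two arguments.\<close>

lemma commutator_acts_nilpotently:
  assumes "solvable_lie br"
  shows "acts_nilpotently (commutator br UNIV UNIV)"
proof -
  let ?D = "derived_series br"
  obtain n where n: "?D n = {0}" using assms by (auto simp: solvable_lie_def)
  have "acts_nilpotently (?D k)" if "k \<le> n" "1 \<le> k" for k
    using that
  proof (induction k rule: inc_induct)
    case base
    have "0 \<in> K" if "ideal K" for K using that idealD(1) subspace_0 by blast
    then show ?case by (force simp: n acts_nilpotently_def)
  next
    case (step k)
    then obtain j where j: "k = Suc j" by (cases k) auto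
    let ?C = "commutator br UNIV (?D k)"
    note Dk = ideal_derived_series[of k]
    have C: "ideal ?C" by (intro ideal_commutator ideal_UNIV Dk)
    have CD: "?C \<subseteq> ?D k"
      unfolding commutator_def using idealD[OF Dk] by (intro span_minimal) auto
    have nC: "acts_nilpotently ?C"
    proof (rule acts_nilpotently_step[OF C ideal_derived_series[of "Suc k"]])
      show "acts_nilpotently (?D (Suc k))" using step by simp
      show "?C = span {br x y |x y. x \<in> UNIV \<and> y \<in> ?D k}" by (simp only: commutator_def)
      fix n assume "n \<in> {br x y |x y. x \<in> UNIV \<and> y \<in> ?D k}"
      then obtain x y where xy: "n = br x y" "y \<in> ?D k" by blast
      \<comment> \<open>The arguments are swapped so that the one bracketed with \<open>n\<close>
        again is \<open>y\<close>, which lies in \<open>?D k\<close> together with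
        \<open>n\<close>.\<close>
      have "n = br y (- x)" using xy br_anti[of y x] by simp
      moreover have "br y n \<in> ?D (Suc k)"
        using xy idealD[OF Dk] by (simp add: br_in_commutator)
      ultimately show "\<exists>x z. n = br x z \<and> br x n \<in> ?D (Suc k)" by blast
    next
      fix a b assume "a \<in> ?C" "b \<in> ?C"
      then show "br a b \<in> ?D (Suc k)" using CD by (auto intro!: br_in_commutator)
    qed
    show ?case
    proof (rule acts_nilpotently_step[OF Dk C nC])
      show "?D k = span {br x y |x y. x \<in> ?D j \<and> y \<in> ?D j}" by (simp add: j commutator_def)
      fix n assume n: "n \<in> {br x y |x y. x \<in> ?D j \<and> y \<in> ?D j}"
      then have "n \<in> ?D k" by (auto simp: j br_in_commutator)
      then show "\<exists>x z. n = br x z \<and> br x n \<in> ?C" using n by (auto intro!: br_in_commutator)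
    next
      fix a b assume "a \<in> ?D k" "b \<in> ?D k"
      then show "br a b \<in> ?C" by (auto intro!: br_in_commutator)
    qed
  qed
  from this[of 1] show ?thesis
  proof (cases "n = 0")
    case True
    then have "(UNIV :: 'a set) = {0}" using n by simp
    then have "M \<subseteq> K" if "ideal K" for K M
      using subspace_0[OF idealD(1)[OF that]] by (metis UNIV_I singletonD subsetI)
    then show ?thesis unfolding acts_nilpotently_def by blast
  qed (auto simp: Suc_le_eq)
qed

text \<open>A \<open>P\<close> of maximal dimension satisfying \<Phi> must be \<open>M\<close>:
  otherwise the elements of \<open>M\<close> that \<open>I\<close> sends into \<open>P\<close> form
  a strictly larger ideal, to which the step applies.\<close>

lemma central_series_induct [consumes 2, case_names zero step]:
  assumes I: "ideal I" "acts_nilpotently I" and M: "ideal M"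
    and zero: "\<Phi> {0}"
    and step: "\<And>P P'. ideal P \<Longrightarrow> ideal P' \<Longrightarrow> P \<subseteq> P' \<Longrightarrow> P' \<subseteq> M \<Longrightarrow>
      (\<And>a v. a \<in> I \<Longrightarrow> v \<in> P' \<Longrightarrow> br a v \<in> P) \<Longrightarrow> \<Phi> P \<Longrightarrow> \<Phi> P'"
  shows "\<Phi> M"
proof -
  let ?Q = "\<lambda>P. ideal P \<and> P \<subseteq> M \<and> \<Phi> P"
  have Q0: "?Q {0}" using ideal_zero zero subspace_0[OF idealD(1)[OF M]] by blast
  have bound: "\<forall>P. ?Q P \<longrightarrow> dim P < Suc (DIM('a))"
    using dim_subset_UNIV by (auto simp: less_Suc_eq_le)
  obtain P where P: "?Q P" and max: "\<And>P'. ?Q P' \<Longrightarrow> dim P' \<le> dim P"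
    using ex_has_greatest_nat[of ?Q, OF Q0 bound] by (elim exE conjE) (rule that, auto)
  show ?thesis
  proof (cases "P = M")
    case False
    let ?P = "{v \<in> M. \<forall>a\<in>I. br a v \<in> P}"
    have P': "ideal ?P" using I P M by (simp add: ideal_transporter)
    have sub: "P \<subseteq> ?P" using P idealD(2)[of P] by auto
    have "\<Phi> ?P" by (rule step[of P]) (use P P' sub in auto)
    then have "dim ?P \<le> dim P" using max P' by blast
    then have "P = ?P"
      using subspace_dim_equal[OF _ _ sub] P P' idealD(1) by blast
    moreover obtain v where "v \<in> M - P" "\<forall>a\<in>I. br a v \<in> P"
      using I(2) P M False unfolding acts_nilpotently_def by blast
    ultimately show ?thesis by blast
  qed (use P in simp)
qed

lemma commutator_proper:
  assumes "solvable_lie br" "commutator br UNIV UNIV = UNIV"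
  shows "x = (0::'a)"
proof -
  have "derived_series br n = UNIV" for n
    using assms(2) by (induction n) auto
  then show ?thesis using assms(1) by (auto simp: solvable_lie_def)
qed

end

section \<open>The Chern connection\<close>

locale real_inner_product =
  fixes g :: "'a::euclidean_space \<Rightarrow> 'a \<Rightarrow> real"
  assumes inner_product: "inner_product g"
begin

lemma bilinear_g: "bilinear g"
  using inner_product by (simp add: inner_product_def)

lemmas g_simps [simp] =
  bilinear_ladd[OF bilinear_g] bilinear_radd[OF bilinear_g]
  bilinear_lsub[OF bilinear_g] bilinear_rsub[OF bilinear_g]
  bilinear_lneg[OF bilinear_g] bilinear_rneg[OF bilinear_g]
  bilinear_lzero[OF bilinear_g] bilinear_rzero[OF bilinear_g]
  bilinear_lmul[OF bilinear_g] bilinear_rmul[OF bilinear_g]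

lemma g_sym: "g x y = g y x"
  using inner_product by (simp add: inner_product_def)

lemma g_pos: "x \<noteq> 0 \<Longrightarrow> g x x > 0"
  using inner_product by (simp add: inner_product_def)

lemma g_nonneg [simp]: "g x x \<ge> 0"
  using g_pos[of x] by (cases "x = 0") auto

lemma g_eq_0 [simp]: "g x x = 0 \<longleftrightarrow> x = 0"
  by (cases "x = 0") (auto dest: g_pos)

lemma g_eqI:
  assumes "\<And>z. g x z = g y z"
  shows "x = y"
proof -
  have "g (x - y) (x - y) = 0" using assms[of "x - y"] by (simp del: g_eq_0)
  then have "x - y = 0" using g_eq_0 by blast
  then show ?thesis by simp
qed

lemma g_sum_left: "g (sum f E) y = (\<Sum>e\<in>E. g (f e) y)"
  using linear_sum[of "\<lambda>x. g x y"] bilinear_g by (simp add: bilinear_def)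

definition orthonormal :: "'a set \<Rightarrow> bool" where
  "orthonormal E \<longleftrightarrow> finite E \<and> (\<forall>e\<in>E. \<forall>f\<in>E. g e f = (if e = f then 1 else 0))"

definition proj :: "'a set \<Rightarrow> 'a \<Rightarrow> 'a" where
  "proj E v = (\<Sum>e\<in>E. g v e *\<^sub>R e)"

lemma proj_mem: "proj E v \<in> span E"
  unfolding proj_def by (intro span_sum span_scale span_base)

lemma g_proj:
  assumes "orthonormal E" "f \<in> E"
  shows "g (proj E v) f = g v f"
proof -
  have "g (proj E v) f = (\<Sum>e\<in>E. g v e * g e f)"
    by (simp add: proj_def g_sum_left)
  also have "\<dots> = (\<Sum>e\<in>E. if e = f then g v e else 0)"
    using assms by (intro sum.cong) (auto simp: orthonormal_def)
  also have "\<dots> = g v f" using assms by (simp add: orthonormal_def)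
  finally show ?thesis .
qed

lemma proj_orthogonal:
  assumes "orthonormal E" "y \<in> span E"
  shows "g (v - proj E v) y = 0"
proof -
  define w where "w = v - proj E v"
  have "g w y = 0"
    using assms(2)
  proof (induction rule: span_induct)
    case base
    show ?case by (simp add: subspace_def)
  next
    case (step y)
    then show ?case using g_proj[OF assms(1)] by (simp add: w_def)
  qed
  then show ?thesis by (simp only: w_def)
qed

lemma proj_span:
  assumes "orthonormal E" "v \<in> span E"
  shows "proj E v = v"
proof -
  have "g (v - proj E v) (v - proj E v) = 0"
    by (intro proj_orthogonal assms(1) span_diff assms(2) proj_mem)
  then have "v - proj E v = 0" using g_eq_0 by blast
  then show ?thesis by simp
qed

lemma norm_proj:
  assumes "orthonormal E"
  shows "g (v - proj E v) (v - proj E v) = g v v - (\<Sum>e\<in>E. (g v e)\<^sup>2)"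
proof -
  have "g (v - proj E v) (proj E v) = 0"
    by (intro proj_orthogonal assms proj_mem)
  then have "g (v - proj E v) (v - proj E v) = g v v - g (proj E v) v" by simp
  moreover have "g (proj E v) v = (\<Sum>e\<in>E. (g v e)\<^sup>2)"
    unfolding proj_def g_sum_left
    by (intro sum.cong) (auto simp: power2_eq_square intro: g_sym)
  ultimately show ?thesis by simp
qed

lemma parseval:
  assumes "orthonormal E" "v \<in> span E"
  shows "g v v = (\<Sum>e\<in>E. (g v e)\<^sup>2)"
  using norm_proj[OF assms(1), of v] proj_span[OF assms] by simp

text \<open>Gram-Schmidt: the normalised residual of the new vector is adjoined, unless it
  vanishes.\<close>

lemma ex_orthonormal_span:
  assumes "finite T"
  shows "\<exists>E. orthonormal E \<and> span E = span T"
  using assms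
proof (induction T)
  case empty
  show ?case by (rule exI[of _ "{}"]) (simp add: orthonormal_def)
next
  case (insert v T)
  then obtain E where E: "orthonormal E" "span E = span T" by blast
  define r where "r = v - proj E v"
  show ?case
  proof (cases "r = 0")
    case True
    then have "v \<in> span T" using proj_mem[of E v] E by (simp add: r_def)
    then show ?thesis using E span_redundant by metis
  next
    case False
    define s where "s = (1 / sqrt (g r r)) *\<^sub>R r"
    have rr: "g r r > 0" using False by (rule g_pos)
    have "g r e = 0" if "e \<in> E" for e
      using proj_orthogonal[OF E(1), of e v] that by (simp add: r_def span_base)
    then have se: "g s e = 0" "g e s = 0" if "e \<in> E" for e
      using that by (simp_all add: s_def g_sym[of e r])
    have "g s s = 1" using False rr by (simp add: s_def)
    then have on: "orthonormal (insert s E)" using E(1) se by (auto simp: orthonormal_def)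
    have r: "r = sqrt (g r r) *\<^sub>R s" using False by (simp add: s_def)
    have "v = r + proj E v" by (simp add: r_def)
    moreover have "r \<in> span (insert s E)" by (subst r) (simp add: span_base span_scale)
    moreover have sub: "span E \<subseteq> span (insert s E)" by (simp add: span_mono subset_insertI)
    ultimately have "v \<in> span (insert s E)" using proj_mem[of E v] by (metis span_add subsetD)
    moreover have sub': "span T \<subseteq> span (insert v T)" by (simp add: span_mono subset_insertI)
    moreover have "s \<in> span (insert v T)"
      unfolding s_def r_def
      using proj_mem[of E v] sub' E(2) by (intro span_scale span_diff) (auto simp: span_base)
    moreover have "T \<subseteq> span E" "E \<subseteq> span T" using E span_superset by blast+
    ultimately have "span (insert s E) = span (insert v T)"
      using sub by (subst span_eq) auto
    then show ?thesis using on by blast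
  qed
qed

lemma ex_orthonormal_basis:
  assumes "subspace S"
  obtains E where "orthonormal E" "span E = S"
proof -
  obtain T where T: "T \<subseteq> S" "independent T" "S \<subseteq> span T"
    by (rule basis_exists[of S])
  have "span T = S" using T(3) span_minimal[OF T(1) assms] by (rule antisym[rotated])
  then show ?thesis
    using ex_orthonormal_span[OF independent_imp_finite[OF T(2)]] that by auto
qed

lemma orthogonal_decomposition:
  assumes "subspace S"
  obtains p where "p \<in> S" "\<And>y. y \<in> S \<Longrightarrow> g (x - p) y = 0"
proof -
  obtain E where "orthonormal E" "span E = S" using ex_orthonormal_basis[OF assms] .
  then show ?thesis using that[of "proj E x"] proj_mem proj_orthogonal by blast
qed

end

section \<open>The Chern connection and its (0,1)-part\<close>

locale chern_lie_alg = lie_alg br + real_inner_product g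
  for br :: "'a::euclidean_space \<Rightarrow> 'a \<Rightarrow> 'a" and g :: "'a \<Rightarrow> 'a \<Rightarrow> real" +
  fixes J :: "'a \<Rightarrow> 'a" and D :: "'a \<Rightarrow> 'a \<Rightarrow> 'a"
  assumes hermitian: "hermitian_structure br J g"
    and chern: "chern_connection br J g D"
begin

lemma linear_J: "linear J"
  using hermitian unfolding hermitian_structure_def complex_structure_def by blast

lemma JJ [simp]: "J (J x) = - x"
  using hermitian unfolding hermitian_structure_def complex_structure_def by blast

lemmas J_simps [simp] = linear_add[OF linear_J] linear_diff[OF linear_J] linear_neg[OF linear_J]
  linear_0[OF linear_J] linear_cmul[OF linear_J]

lemma integrable: "br x y - br (J x) (J y) + J (br (J x) y) + J (br x (J y)) = 0"
  using hermitian unfolding hermitian_structure_def complex_structure_def by blast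

lemma g_J [simp]: "g (J x) (J y) = g x y"
  using hermitian unfolding hermitian_structure_def by blast

lemma g_J_left: "g (J x) y = - g x (J y)"
  using g_J[of x "J y"] by simp

lemma bilinear_D: "bilinear D"
  using chern unfolding chern_connection_def by blast

lemmas D_simps [simp] =
  bilinear_ladd[OF bilinear_D] bilinear_radd[OF bilinear_D]
  bilinear_lsub[OF bilinear_D] bilinear_rsub[OF bilinear_D]
  bilinear_lneg[OF bilinear_D] bilinear_rneg[OF bilinear_D]
  bilinear_lzero[OF bilinear_D] bilinear_rzero[OF bilinear_D]
  bilinear_lmul[OF bilinear_D] bilinear_rmul[OF bilinear_D]

lemma D_J [simp]: "D x (J y) = J (D x y)"
  using chern unfolding chern_connection_def by blast

lemma D_skew: "g (D x y) z = - g y (D x z)"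
proof -
  have "g (D x y) z + g y (D x z) = 0"
    using chern unfolding chern_connection_def by blast
  then show ?thesis by linarith
qed

text \<open>Real and imaginary part of T(X, conj Y) = 0 for X = x - sqrt(-1) J x and Y = y -
  sqrt(-1) J y.\<close>

lemma torsion_J:
  "torsion br D x y + torsion br D (J x) (J y) = 0"
  "torsion br D x (J y) = torsion br D (J x) y"
proof -
  have "complex_bilinear_ext (torsion br D) (x, - J x) (complex_conj (y, - J y)) = 0"
    using chern unfolding chern_connection_def type_10_def by blast
  then show "torsion br D x y + torsion br D (J x) (J y) = 0"
    "torsion br D x (J y) = torsion br D (J x) y"
    by (simp_all add: zero_prod_def torsion_def algebra_simps)
qed

text \<open>Identify \<open>x\<close> with \<open>X = x - sqrt(-1) J x\<close>. Then \<open>A x\<close> is \<open>Y \<mapsto> \<nabla> Y\<close> in the direction conjugate to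
  \<open>X\<close>, i.e. the \<open>(1,0)\<close>-part of the bracket of \<open>Y\<close> with that vector; it is conjugate linear
  in \<open>x\<close>, and \<open>A_adj x\<close> is its adjoint.\<close>

definition A :: "'a \<Rightarrow> 'a \<Rightarrow> 'a" where
  "A x y = D x y + J (D (J x) y)"

definition A_adj :: "'a \<Rightarrow> 'a \<Rightarrow> 'a" where
  "A_adj x y = J (D (J x) y) - D x y"

lemma A_simps [simp]:
  "A (x + x') y = A x y + A x' y" "A x (y + y') = A x y + A x y'"
  "A (x - x') y = A x y - A x' y" "A x (y - y') = A x y - A x y'"
  "A (- x) y = - A x y" "A x (- y) = - A x y" "A 0 y = 0" "A x 0 = 0"
  "A (r *\<^sub>R x) y = r *\<^sub>R A x y" "A x (r *\<^sub>R y) = r *\<^sub>R A x y"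
  "A (J x) y = - J (A x y)" "A x (J y) = J (A x y)"
  by (simp_all add: A_def algebra_simps)

lemma A_adj_simps [simp]:
  "A_adj (x + x') y = A_adj x y + A_adj x' y" "A_adj x (y + y') = A_adj x y + A_adj x y'"
  "A_adj (x - x') y = A_adj x y - A_adj x' y" "A_adj x (y - y') = A_adj x y - A_adj x y'"
  "A_adj (- x) y = - A_adj x y" "A_adj x (- y) = - A_adj x y" "A_adj 0 y = 0" "A_adj x 0 = 0"
  "A_adj (r *\<^sub>R x) y = r *\<^sub>R A_adj x y" "A_adj x (r *\<^sub>R y) = r *\<^sub>R A_adj x y"
  "A_adj (J x) y = J (A_adj x y)" "A_adj x (J y) = J (A_adj x y)"
  by (simp_all add: A_adj_def algebra_simps)

lemma A_adj_left: "g (A_adj x y) z = g y (A x z)"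
  by (simp add: A_def A_adj_def g_J_left D_skew)

lemma A_left: "g (A x y) z = g y (A_adj x z)"
  by (metis A_adj_left g_sym)

lemma D_eq: "D x y = (1/2) *\<^sub>R (A x y - A_adj x y)"
  by (simp add: A_def A_adj_def scaleR_2[symmetric])

lemma D_J_J: "D (J x) (J y) = (1/2) *\<^sub>R (A x y + A_adj x y)"
  by (simp add: A_def A_adj_def scaleR_2[symmetric])

text \<open>Twice the difference of the two sides combines the torsion identities with
  integrability. Thus \<open>A\<close> depends on the bracket and \<open>J\<close> only; the metric
  enters through \<open>A_adj\<close>.\<close>

lemma A_br: "A x y = br x y + J (br (J x) y)"
proof -
  let ?T = "torsion br D"
  have "2 *\<^sub>R (A x y - (br x y + J (br (J x) y)))
      = (?T x y + ?T (J x) (J y)) - J (?T x (J y) - ?T (J x) y)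
        - (br x y - br (J x) (J y) + J (br (J x) y) + J (br x (J y)))"
    by (simp add: torsion_def A_def scaleR_2 algebra_simps)
  also have "\<dots> = 0" by (simp only: torsion_J(1) torsion_J(2)[of x y] integrable) simp
  finally show ?thesis by simp
qed

text \<open>The (0,2)-part of the curvature vanishes: by integrability the bracket of conj X and
  conj Y is conj P for p = \<open>br x y - br (J x) (J y)\<close>. After \<open>A_br\<close> this is
  the Jacobi identity.\<close>

lemma A_A_commutator: "A x (A y z) - A y (A x z) = A (br x y - br (J x) (J y)) z"
proof -
  let ?p = "br x y - br (J x) (J y)" and ?q = "br (J x) y + br x (J y)"
  have "?p = - J ?q" using integrable[of x y] by (simp add: algebra_simps eq_neg_iff_add_eq_0)
  then have Jp: "J ?p = ?q" by simp
  have A: "A u (A v z) = br u (br v z) + J (br (J u) (br v z)) + J (br u (br (J v) z))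
      - br (J u) (br (J v) z)" for u v
  proof -
    have "A u (A v z) = A u (br v z) + J (A u (br (J v) z))" by (simp add: A_br[of v])
    also have "\<dots> = br u (br v z) + J (br (J u) (br v z)) + J (br u (br (J v) z))
        - br (J u) (br (J v) z)" by (simp add: A_br[of u])
    finally show ?thesis .
  qed
  have "A ?p z = br ?p z + J (br ?q z)" by (simp only: A_br[of ?p] Jp)
  moreover have br_br: "br u (br v z) - br v (br u z) = br (br u v) z" for u v
    by (simp add: br_deriv[of u v z])
  have "A x (A y z) - A y (A x z) = (br x (br y z) - br y (br x z))
      + J (br (J x) (br y z) - br y (br (J x) z)) + J (br x (br (J y) z) - br (J y) (br x z))
      - (br (J x) (br (J y) z) - br (J y) (br (J x) z))"
    unfolding A[of x y] A[of y x] by (simp add: algebra_simps)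
  ultimately show ?thesis by (simp only: br_br br_simps J_simps) (simp add: algebra_simps)
qed

text \<open>\<open>A\<close> is conjugate linear in the first argument and linear in the second, so
  the diagonal at \<open>x + y\<close> and \<open>x + J y\<close> determines it.\<close>

lemma A_eq_0_of_diagonal:
  assumes S: "subspace S" "\<And>x. x \<in> S \<Longrightarrow> J x \<in> S" and diag: "\<And>x. x \<in> S \<Longrightarrow> A x x = 0"
    and xy: "x \<in> S" "y \<in> S"
  shows "A x y = 0"
proof -
  have "A (x + y) (x + y) = 0" "A (x + J y) (x + J y) = 0"
    using S(2)[OF xy(2)] by (intro diag subspace_add[OF S(1)] xy; assumption)+
  then have "A y x + A x y = 0" and "J (A x y) - J (A y x) = 0"
    using diag[OF xy(1)] diag[OF xy(2)] by simp_all
  moreover have "A x y - A y x = - J (J (A x y) - J (A y x))" by simp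
  ultimately have "A y x + A x y = 0" "A x y = A y x" by simp_all
  then show ?thesis by (simp add: scaleR_2[symmetric])
qed

text \<open>Once \<open>D\<close> is written through \<open>A\<close> and \<open>A_adj\<close>, the
  squares of \<open>A x\<close> and of \<open>A_adj x\<close> cancel;
  \<open>br x (J x) = J (A x x)\<close> yields the cubic term.\<close>

lemma holomorphic_curvature_eq:
  "2 * curvature br g D x (J x) (J x) x
     = g (A_adj x x) (A_adj x x) - g (A x x) (A x x) - 2 * g (A (A x x) x) x"
proof -
  let ?a = "A x x" and ?s = "A_adj x x"
  have "J (br x (J x)) = - A x x" by (simp add: A_br br_anti[of "J x" x])
  then have "J (J (br x (J x))) = - J (A x x)" by simp
  then have br: "br x (J x) = J (A x x)" by simp
  have 1: "D x (D (J x) (J x)) = (1/4) *\<^sub>R (A x ?a + A x ?s - A_adj x ?a - A_adj x ?s)"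
    unfolding D_J_J D_eq[of x] by (simp add: algebra_simps)
  have 2: "D (J x) (D x (J x)) = (1/4) *\<^sub>R (A x ?a - A x ?s + A_adj x ?a - A_adj x ?s)"
  proof -
    have "D (J x) (D x (J x)) = D (J x) (J (D x x))" by simp
    also have "\<dots> = (1/2) *\<^sub>R (A x (D x x) + A_adj x (D x x))" by (rule D_J_J)
    also have "\<dots> = (1/4) *\<^sub>R (A x ?a - A x ?s + A_adj x ?a - A_adj x ?s)"
      unfolding D_eq[of x] by (simp add: algebra_simps)
    finally show ?thesis .
  qed
  have 3: "D (br x (J x)) (J x) = (1/2) *\<^sub>R (A ?a x + A_adj ?a x)"
    unfolding br by (rule D_J_J)
  have "g (A_adj ?a x) x = g (A ?a x) x" using A_adj_left[of ?a x x] g_sym by simp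
  moreover have "g (A x ?s) x = g ?s ?s" by (simp add: A_left)
  moreover have "g (A_adj x ?a) x = g ?a ?a" by (simp add: A_adj_left)
  ultimately show ?thesis
    unfolding curvature_def 1 2 3 by (simp add: field_simps)
qed

end

section \<open>Constant holomorphic sectional curvature\<close>

locale constant_hsc_lie_alg = chern_lie_alg br g J D
  for br :: "'a::euclidean_space \<Rightarrow> 'a \<Rightarrow> 'a" and g J D +
  fixes c :: real
  assumes solvable: "solvable_lie br"
    and J_commutator: "J ` commutator br UNIV UNIV = commutator br UNIV UNIV"
    and constant_hsc: "\<And>x. x \<noteq> 0 \<Longrightarrow> holomorphic_sectional_curvature br J g D x = c"
begin

abbreviation W :: "'a set" where
  "W \<equiv> commutator br UNIV UNIV"

lemma ideal_W: "ideal W"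
  by (intro ideal_commutator ideal_UNIV)

lemma subspace_W: "subspace W"
  using idealD(1)[OF ideal_W] .

lemma J_W: "x \<in> W \<Longrightarrow> J x \<in> W"
  using J_commutator by blast

lemma br_W: "br x y \<in> W"
  by (simp add: br_in_commutator)

text \<open>Here the commutator being complex enters: \<open>J (br (J x) y)\<close> stays in
  \<open>W\<close>.\<close>

lemma A_W: "A x y \<in> W"
  unfolding A_br by (intro subspace_add subspace_W J_W br_W)

lemma A_adj_orthogonal_W:
  assumes "\<And>w. w \<in> W \<Longrightarrow> g u w = 0"
  shows "A_adj x u = 0"
  by (rule g_eqI) (simp add: A_adj_left assms A_W)

lemma hsc_eq:
  "g (A_adj x x) (A_adj x x) - g (A x x) (A x x) - 2 * g (A (A x x) x) x = 2 * c * (g x x)\<^sup>2"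
proof (cases "x = 0")
  case False
  have "sqrt (g x x) ^ 4 = (sqrt (g x x) ^ 2) ^ 2" by (simp only: power_mult[symmetric]) simp
  also have "\<dots> = (g x x)\<^sup>2" by (simp only: real_sqrt_pow2[OF g_nonneg])
  finally have "curvature br g D x (J x) (J x) x / (g x x)\<^sup>2 = c"
    using constant_hsc[OF False] by (simp add: holomorphic_sectional_curvature_def)
  then have "curvature br g D x (J x) (J x) x = c * (g x x)\<^sup>2"
    using False by (simp add: divide_eq_eq)
  then show ?thesis using holomorphic_curvature_eq[of x] by simp
qed simp

lemma nilpotent_W: "acts_nilpotently W"
  using commutator_acts_nilpotently[OF solvable] .

lemma c_eq_0:
  assumes "W \<noteq> {0}"
  shows "c = 0"
proof (rule antisym)
  have "W \<noteq> UNIV"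
    using commutator_proper[OF solvable] assms subspace_0[OF subspace_W] by auto
  then obtain x where x: "x \<notin> W" by blast
  obtain p where p: "p \<in> W" "\<And>y. y \<in> W \<Longrightarrow> g (x - p) y = 0"
    using orthogonal_decomposition[OF subspace_W] by blast
  define u where "u = x - p"
  have u: "g u w = 0" if "w \<in> W" for w using p(2)[OF that] by (simp only: u_def)
  have "u \<noteq> 0" using p x by (auto simp: u_def)
  then have "(g u u)\<^sup>2 > 0" using g_pos zero_less_power by blast
  \<comment> \<open>Orthogonality to \<open>W\<close> leaves -|A u u|^2 = 2c|u|^4.\<close>
  moreover have "g (A (A u u) u) u = 0" using u[OF A_W] g_sym by metis
  then have "2 * c * (g u u)\<^sup>2 \<le> 0"
    using hsc_eq[of u] A_adj_orthogonal_W[OF u, of u] by (smt (verit) g_nonneg g_simps(7))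
  ultimately show "c \<le> 0" by (auto simp: mult_le_0_iff)
  have "{0} \<subset> W" using assms subspace_0[OF subspace_W] by auto
  then obtain v where v: "v \<in> W" "v \<noteq> 0" "\<forall>a\<in>W. br a v \<in> {0}"
    using nilpotent_W ideal_zero ideal_W unfolding acts_nilpotently_def by blast
  \<comment> \<open>Both \<open>v\<close> and \<open>J v\<close> lie in \<open>W\<close>, which
    centralises \<open>v\<close>; what remains is |A* v v|^2 = 2c|v|^4.\<close>
  then have "A v v = 0" using J_W[OF v(1)] by (simp add: A_br)
  then have "2 * c * (g v v)\<^sup>2 \<ge> 0" using hsc_eq[of v] by (smt (verit) g_nonneg A_simps(7) g_simps(7))
  moreover have "(g v v)\<^sup>2 > 0" using g_pos[OF v(2)] by (rule zero_less_power)
  ultimately show "0 \<le> c" by (auto simp: zero_le_mult_iff)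
qed

end

section \<open>Zero curvature: polarisation, and vanishing of \<open>A\<close> on
  \<open>W\<close>\<close>

locale zero_hsc_lie_alg = constant_hsc_lie_alg br g J D 0
  for br :: "'a::euclidean_space \<Rightarrow> 'a \<Rightarrow> 'a" and g J D
begin

lemma hsc_0: "g (A_adj x x) (A_adj x x) = g (A x x) (A x x) + 2 * g (A (A x x) x) x"
  using hsc_eq[of x] by simp

text \<open>The curvature identity at \<open>x + w\<close> for \<open>w\<close> among
  \<open>z\<close>, \<open>- z\<close>, \<open>J z\<close>, \<open>- J z\<close> isolates the part
  quadratic in \<open>z\<close>; the hypotheses on \<open>F\<close> remove the other terms.\<close>

lemma polarized_hsc:
  assumes F: "subspace F" "\<And>z. z \<in> F \<Longrightarrow> J z \<in> F"
    and AFF: "\<And>y z. y \<in> F \<Longrightarrow> z \<in> F \<Longrightarrow> A y z = 0"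
    and AxF: "\<And>z. z \<in> F \<Longrightarrow> A x z \<in> F" and AFx: "\<And>z. z \<in> F \<Longrightarrow> A z x \<in> F"
    and Axx: "A x x \<in> F" and orth: "\<And>z. z \<in> F \<Longrightarrow> g x z = 0" and z: "z \<in> F"
  shows "g (A_adj x z + A_adj z x) (A_adj x z + A_adj z x) + g (A z x) (A z x) = g (A x z) (A x z)"
proof -
  have orth': "g z x = 0" if "z \<in> F" for z using orth[OF that] g_sym by simp
  have A_adj_diag: "A_adj w w = 0" if "w \<in> F" for w
    using hsc_0[of w] AFF[OF that that] by simp
  have xx: "g (A_adj x x) (A_adj x x) = g (A x x) (A x x)"
    using hsc_0[of x] orth'[OF AFx[OF Axx]] by simp
  have eq: "g (A_adj x x + (A_adj x w + A_adj w x)) (A_adj x x + (A_adj x w + A_adj w x))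
      = g (A x x + (A x w + A w x)) (A x x + (A x w + A w x))
        + 2 * g (A (A x x) x + (A (A x w) x + A (A w x) x)) w" if w: "w \<in> F" for w
  proof -
    have 1: "A_adj (x + w) (x + w) = A_adj x x + (A_adj x w + A_adj w x)"
      "A (x + w) (x + w) = A x x + (A x w + A w x)"
      using A_adj_diag[OF w] AFF[OF w w] by (simp_all add: algebra_simps)
    have 2: "A (A x x + (A x w + A w x)) (x + w) = A (A x x) x + (A (A x w) x + A (A w x) x)"
      using AFF[OF Axx w] AFF[OF AxF[OF w] w] AFF[OF AFx[OF w] w] by simp
    have 3: "g (A (A x x) x + (A (A x w) x + A (A w x) x)) x = 0"
      using orth'[OF AFx[OF Axx]] orth'[OF AFx[OF AxF[OF w]]] orth'[OF AFx[OF AFx[OF w]]] by simp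
    show ?thesis
      using hsc_0[of "x + w"] 3 unfolding 1 2 bilinear_radd[OF bilinear_g, of _ x w] by simp
  qed
  have pm: "g (A_adj x w + A_adj w x) (A_adj x w + A_adj w x)
      = g (A x w + A w x) (A x w + A w x) + 2 * g (A (A x w) x + A (A w x) x) w" if w: "w \<in> F" for w
  proof -
    define a s b t d where defs: "a = A x x" "s = A_adj x x" "b = A x w + A w x"
      "t = A_adj x w + A_adj w x" "d = A (A x w) x + A (A w x) x"
    \<comment> \<open>Adding the identities for \<open>w\<close> and \<open>- w\<close> leaves the
      part that is even in \<open>w\<close>.\<close>
    have "- w \<in> F" using w F subspace_neg by blast
    from eq[OF this] have "g (s - t) (s - t) = g (a - b) (a - b) + 2 * g (A a x - d) (- w)"
      by (simp add: defs algebra_simps del: g_simps)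
    moreover have "g (s + t) (s + t) = g (a + b) (a + b) + 2 * g (A a x + d) w"
      using eq[OF w] by (simp only: defs)
    ultimately have "g t t = g b b + 2 * g d w"
      using xx[folded defs(1,2)] by (simp add: algebra_simps)
    then show ?thesis by (simp only: defs)
  qed
  \<comment> \<open>Polarising \<open>A_adj w w = 0\<close> at \<open>z\<close> and
    \<open>A z x\<close> turns a cubic term into minus a square.\<close>
  have "A_adj (z + A z x) (z + A z x) = 0"
    using F z AFx by (intro A_adj_diag subspace_add) auto
  then have "A_adj z (A z x) = - A_adj (A z x) z"
    using A_adj_diag[OF z] A_adj_diag[OF AFx[OF z]] by (simp add: algebra_simps eq_neg_iff_add_eq_0)
  have skew: "g (A (A z x) x) z = - g (A z x) (A z x)"
  proof -
    have "g (A (A z x) x) z = g x (A_adj (A z x) z)" by (rule A_left)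
    also have "\<dots> = - g x (A_adj z (A z x))" using \<open>A_adj z (A z x) = - A_adj (A z x) z\<close> by simp
    also have "\<dots> = - g (A z x) (A z x)" by (simp add: A_left)
    finally show ?thesis .
  qed
  define b e s p q where defs: "b = A x z" "e = A z x" "s = A_adj x z + A_adj z x"
    "p = A (A x z) x" "q = A (A z x) x"
  have "g s s = g (b + e) (b + e) + 2 * g (p + q) z"
    using pm[OF z] by (simp only: defs)
  \<comment> \<open>Passing to \<open>J z\<close> flips the sign of \<open>e\<close> relative to
    \<open>b\<close> and of \<open>p\<close> relative to \<open>q\<close>, so averaging with the
    previous identity cancels \<open>p\<close> and the cross term.\<close>
  moreover have "g (J s) (J s) = g (J (b - e)) (J (b - e)) + 2 * g (J (q - p)) (J z)"
    using pm[OF F(2)[OF z]] by (simp add: defs del: g_simps g_J)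
  then have "g s s = g (b - e) (b - e) + 2 * g (q - p) z" by (simp only: g_J)
  moreover have "g q z = - g e e" using skew by (simp only: defs)
  ultimately have "g s s + g e e = g b b" by simp
  then show ?thesis by (simp only: defs)
qed

text \<open>Summing the polarised identity over an orthonormal basis of \<open>F\<close>, the operator
  \<open>z \<mapsto> A x z\<close> and its adjoint on \<open>F\<close> contribute equally, which forces all other
  terms to vanish.\<close>

lemma normal_on:
  assumes F: "subspace F" "\<And>z. z \<in> F \<Longrightarrow> J z \<in> F"
    and AFF: "\<And>y z. y \<in> F \<Longrightarrow> z \<in> F \<Longrightarrow> A y z = 0"
    and AxF: "\<And>z. z \<in> F \<Longrightarrow> A x z \<in> F" and AFx: "\<And>z. z \<in> F \<Longrightarrow> A z x \<in> F"
    and Axx: "A x x \<in> F" and orth: "\<And>z. z \<in> F \<Longrightarrow> g x z = 0" and z: "z \<in> F"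
  shows "A z x = 0" "A_adj x z + A_adj z x \<in> F"
    "g (A_adj x z + A_adj z x) (A_adj x z + A_adj z x) = g (A x z) (A x z)"
proof -
  define \<sigma> where "\<sigma> z = A_adj x z + A_adj z x" for z
  have polar: "g (\<sigma> z) (\<sigma> z) + g (A z x) (A z x) = g (A x z) (A x z)" if "z \<in> F" for z
    unfolding \<sigma>_def by (rule polarized_hsc[OF assms(1-7) that])
  obtain E where E: "orthonormal E" "span E = F" using ex_orthonormal_basis[OF F(1)] .
  have EF: "e \<in> F" if "e \<in> E" for e using that E(2) span_base by blast
  have fin: "finite E" using E(1) by (simp add: orthonormal_def)
  \<comment> \<open>Compressed to \<open>F\<close>, \<sigma> is the adjoint of \<open>A x\<close>,
    because \<open>A z\<close> vanishes on \<open>F\<close>.\<close>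
  have \<sigma>_g: "g (\<sigma> z) y = g z (A x y)" if "z \<in> F" "y \<in> F" for y z
    using AFF[OF that] by (simp add: \<sigma>_def A_adj_left)
  let ?\<rho> = "\<lambda>z. \<sigma> z - proj E (\<sigma> z)"
  have "(\<Sum>z\<in>E. g (?\<rho> z) (?\<rho> z)) = (\<Sum>z\<in>E. g (\<sigma> z) (\<sigma> z)) - (\<Sum>z\<in>E. \<Sum>y\<in>E. (g (\<sigma> z) y)\<^sup>2)"
    unfolding norm_proj[OF E(1)] by (rule sum_subtractf)
  \<comment> \<open>A matrix and its transpose have the same sum of squared entries.\<close>
  also have "(\<Sum>z\<in>E. \<Sum>y\<in>E. (g (\<sigma> z) y)\<^sup>2) = (\<Sum>y\<in>E. \<Sum>z\<in>E. (g (A x y) z)\<^sup>2)"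
    by (subst sum.swap) (intro sum.cong refl, simp add: \<sigma>_g EF g_sym[of _ "A x _"])
  also have "\<dots> = (\<Sum>y\<in>E. g (A x y) (A x y))"
    using parseval[OF E(1)] AxF EF E(2) by (intro sum.cong) auto
  also have "\<dots> = (\<Sum>y\<in>E. g (\<sigma> y) (\<sigma> y) + g (A y x) (A y x))"
    using polar EF by (intro sum.cong) auto
  finally have "(\<Sum>z\<in>E. g (?\<rho> z) (?\<rho> z) + g (A z x) (A z x)) = 0"
    by (simp add: sum.distrib del: g_simps)
  then have "\<forall>z\<in>E. g (?\<rho> z) (?\<rho> z) + g (A z x) (A z x) = 0"
    by (subst (asm) sum_nonneg_eq_0_iff) (auto simp: fin add_nonneg_nonneg simp del: g_simps)
  then have *: "?\<rho> z = 0" "A z x = 0" if "z \<in> E" for z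
    using that g_nonneg[of "?\<rho> z"] g_nonneg[of "A z x"]
    by (smt (verit) g_eq_0)+
  have z': "z \<in> span E" using z E(2) by simp
  then show zx: "A z x = 0"
    by (induction rule: span_induct) (use * in \<open>auto simp: subspace_def\<close>)
  show "A_adj x z + A_adj z x \<in> F"
    using z'
  proof (induction rule: span_induct)
    case base
    show ?case
    proof (simp add: subspace_def, intro conjI allI impI)
      show "0 \<in> F" using F(1) subspace_0 by blast
    next
      fix u v assume "A_adj x u + A_adj u x \<in> F" "A_adj x v + A_adj v x \<in> F"
      then have "(A_adj x u + A_adj u x) + (A_adj x v + A_adj v x) \<in> F" using F(1) subspace_add by blast
      then show "A_adj x u + A_adj x v + (A_adj u x + A_adj v x) \<in> F" by (simp add: algebra_simps)
    next
      fix r u assume "A_adj x u + A_adj u x \<in> F"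
      then have "r *\<^sub>R (A_adj x u + A_adj u x) \<in> F" using F(1) subspace_scale by blast
      then show "r *\<^sub>R A_adj x u + r *\<^sub>R A_adj u x \<in> F" by (simp add: algebra_simps)
    qed
  next
    case (step z)
    then show ?case using *(1)[OF step] proj_mem[of E "\<sigma> z"] E(2) by (simp add: \<sigma>_def)
  qed
  show "g (A_adj x z + A_adj z x) (A_adj x z + A_adj z x) = g (A x z) (A x z)"
    using polar[OF z] zx by (simp add: \<sigma>_def del: g_simps(1,2))
qed

text \<open>Ideals in a central series are not known to be stable under \<open>J\<close>; for a
  subspace \<open>P\<close> this is P + JP, the smallest complex subspace containing it.\<close>

definition J_span :: "'a set \<Rightarrow> 'a set" where
  "J_span P = {a + J b | a b. a \<in> P \<and> b \<in> P}"

lemma J_spanI: "a \<in> P \<Longrightarrow> b \<in> P \<Longrightarrow> a + J b \<in> J_span P"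
  by (auto simp: J_span_def)

lemma J_span_superset:
  assumes "subspace P"
  shows "P \<subseteq> J_span P"
  using J_spanI[of _ P 0] subspace_0[OF assms] by auto

lemma J_span_mono: "P \<subseteq> P' \<Longrightarrow> J_span P \<subseteq> J_span P'"
  by (auto simp: J_span_def)

lemma subspace_J_span:
  assumes "subspace P"
  shows "subspace (J_span P)"
  unfolding subspace_def
proof (intro conjI ballI allI)
  show "0 \<in> J_span P" using J_span_superset[OF assms] subspace_0[OF assms] by blast
next
  fix x y assume "x \<in> J_span P" "y \<in> J_span P"
  then obtain a b a' b' where "x = a + J b" "y = a' + J b'" "a \<in> P" "b \<in> P" "a' \<in> P" "b' \<in> P"
    by (auto simp: J_span_def)
  then show "x + y \<in> J_span P"
    using J_spanI[of "a + a'" P "b + b'"] assms by (simp add: subspace_add algebra_simps)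
next
  fix r x assume "x \<in> J_span P"
  then obtain a b where "x = a + J b" "a \<in> P" "b \<in> P" by (auto simp: J_span_def)
  then show "r *\<^sub>R x \<in> J_span P"
    using J_spanI[of "r *\<^sub>R a" P "r *\<^sub>R b"] assms by (simp add: subspace_scale algebra_simps)
qed

lemma J_J_span:
  assumes "subspace P" "x \<in> J_span P"
  shows "J x \<in> J_span P"
proof -
  obtain a b where "x = a + J b" "a \<in> P" "b \<in> P" using assms(2) by (auto simp: J_span_def)
  then show ?thesis using J_spanI[of "- b" P a] subspace_neg[OF assms(1)] by simp
qed

text \<open>For \<open>u\<close> in \<open>P'\<close>, both brackets in
  \<open>A a u = br a u + J (br (J a) u)\<close> lie in \<open>P\<close>, as \<open>J a\<close> is
  in \<open>W\<close>; complex linearity of \<open>A a\<close> does the rest.\<close>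

lemma A_J_span_step:
  assumes "\<And>a v. a \<in> W \<Longrightarrow> v \<in> P' \<Longrightarrow> br a v \<in> P" "subspace P" "a \<in> W" "y \<in> J_span P'"
  shows "A a y \<in> J_span P"
proof -
  obtain u v where uv: "y = u + J v" "u \<in> P'" "v \<in> P'" using assms(4) by (auto simp: J_span_def)
  have "A a u \<in> J_span P" if "u \<in> P'" for u
    unfolding A_br using that assms(1,3) J_W by (intro J_spanI) auto
  then show ?thesis
    using uv J_J_span[OF assms(2)] subspace_add[OF subspace_J_span[OF assms(2)]] by simp
qed

text \<open>It suffices to treat the diagonal at \<open>y\<close>. The component \<open>x\<close> of
  \<open>y\<close> orthogonal to F = \<open>J_span P\<close> acts on F by an operator that is normal
  and nilpotent, hence zero; normality then also gives \<open>A x x = 0\<close>.\<close>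

lemma A_J_span_eq_0_step:
  assumes P: "ideal P" "ideal P'" "P \<subseteq> P'" "P' \<subseteq> W"
    and series: "\<And>a v. a \<in> W \<Longrightarrow> v \<in> P' \<Longrightarrow> br a v \<in> P"
    and APP: "\<And>y z. y \<in> J_span P \<Longrightarrow> z \<in> J_span P \<Longrightarrow> A y z = 0"
    and yz: "y \<in> J_span P'" "z \<in> J_span P'"
  shows "A y z = 0"
proof -
  let ?F = "J_span P"
  note sub = idealD(1)[OF P(1)] idealD(1)[OF P(2)]
  note F = subspace_J_span[OF sub(1)] J_J_span[OF sub(1)]
  have F'_W: "J_span P' \<subseteq> W"
    using P(4) J_W by (auto simp: J_span_def intro!: subspace_add[OF subspace_W])
  have step: "A a v \<in> ?F" if "a \<in> W" "v \<in> J_span P'" for a v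
    using A_J_span_step[OF series sub(1) that] .
  have FF': "?F \<subseteq> J_span P'" using J_span_mono[OF P(3)] .
  have diag: "A y y = 0" if y: "y \<in> J_span P'" for y
  proof -
    obtain p where p: "p \<in> ?F" "\<And>z. z \<in> ?F \<Longrightarrow> g (y - p) z = 0"
      using orthogonal_decomposition[OF F(1)] by blast
    define x where "x = y - p"
    have xF': "x \<in> J_span P'"
      unfolding x_def using y p FF' by (intro subspace_diff subspace_J_span sub) auto
    have xW: "x \<in> W" using xF' F'_W by blast
    have orth: "g x z = 0" if "z \<in> ?F" for z using p(2)[OF that] by (simp only: x_def)
    have AxF: "A x z \<in> ?F" if "z \<in> ?F" for z using step[OF xW] that FF' by blast
    have AFx: "A z x \<in> ?F" if "z \<in> ?F" for z using step[OF _ xF'] that FF' F'_W by blast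
    have Axx: "A x x \<in> ?F" using step[OF xW xF'] .
    have normal: "A z x = 0" "g (A_adj x z + A_adj z x) (A_adj x z + A_adj z x) = g (A x z) (A x z)"
      if "z \<in> ?F" for z
      by (rule normal_on[OF F(1)]; fact F(2) APP AxF AFx Axx orth that)+
    have \<sigma>: "g (A_adj x z + A_adj z x) y = g z (A x y) + g x (A z y)" for z y
      by (simp add: A_adj_left)
    \<comment> \<open>A second induction, now inside \<open>P\<close>, replaces the nilpotency of
      \<open>A x\<close>.\<close>
    have P0: "\<forall>v\<in>P. A x v = 0"
    proof (rule central_series_induct[OF ideal_W nilpotent_W P(1)])
      show "\<forall>v\<in>{0}. A x v = 0" by simp
    next
      fix K K' assume K: "ideal K" "ideal K'" "K \<subseteq> K'" "K' \<subseteq> P"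
        "\<And>a v. a \<in> W \<Longrightarrow> v \<in> K' \<Longrightarrow> br a v \<in> K" "\<forall>v\<in>K. A x v = 0"
      show "\<forall>v\<in>K'. A x v = 0"
      proof
        fix v assume v: "v \<in> K'"
        then have vF: "v \<in> ?F" using K(4) J_span_superset[OF sub(1)] by blast
        have "A x (br x v) = 0" "A x (br (J x) v) = 0" using K(5,6) xW J_W v by auto
        then have "A x (A x v) = 0" by (simp add: A_br[of x v])
        \<comment> \<open>By normality the adjoint kills \<open>A x v\<close> as well; pairing with
          \<open>v\<close> gives |A x v|^2 = 0.\<close>
        then have "A_adj x (A x v) + A_adj (A x v) x = 0"
          using normal(2)[OF AxF[OF vF]] by (simp del: g_simps(1,2))
        then have "g (A x v) (A x v) + g x (A (A x v) v) = 0" using \<sigma>[of "A x v" v] by simp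
        then show "A x v = 0" using APP[OF AxF[OF vF] vF] by simp
      qed
    qed
    have xF: "A x z = 0" if "z \<in> ?F" for z using that P0 by (auto simp: J_span_def)
    \<comment> \<open>The same argument for \<open>A x x\<close>, paired with
      \<open>x\<close>.\<close>
    have "A_adj x (A x x) + A_adj (A x x) x = 0"
      using normal(2)[OF Axx] xF[OF Axx] by (simp del: g_simps(1,2))
    then have "g (A x x) (A x x) + g x (A (A x x) x) = 0" using \<sigma>[of "A x x" x] by simp
    then have "A x x = 0" using normal(1)[OF Axx] by simp
    moreover have "y = x + p" by (simp add: x_def)
    ultimately show "A y y = 0"
      using xF[OF p(1)] normal(1)[OF p(1)] APP[OF p(1) p(1)] by simp
  qed
  show ?thesis
    by (rule A_eq_0_of_diagonal[OF subspace_J_span[OF sub(2)] J_J_span[OF sub(2)] diag yz])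
qed

lemma A_W_W:
  assumes "y \<in> W" "z \<in> W"
  shows "A y z = 0"
proof -
  have "\<forall>y\<in>J_span W. \<forall>z\<in>J_span W. A y z = 0"
  proof (rule central_series_induct[OF ideal_W nilpotent_W ideal_W])
    show "\<forall>y\<in>J_span {0}. \<forall>z\<in>J_span {0}. A y z = 0" by (simp add: J_span_def)
  next
    fix P P' assume "ideal P" "ideal P'" "P \<subseteq> P'" "P' \<subseteq> W"
      "\<And>a v. a \<in> W \<Longrightarrow> v \<in> P' \<Longrightarrow> br a v \<in> P" "\<forall>y\<in>J_span P. \<forall>z\<in>J_span P. A y z = 0"
    then show "\<forall>y\<in>J_span P'. \<forall>z\<in>J_span P'. A y z = 0"
      using A_J_span_eq_0_step[of P P'] by blast
  qed
  then show ?thesis using assms J_span_superset[OF subspace_W] by blast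
qed

section \<open>The complement of \<open>W\<close>, commuting normal operators and flatness\<close>

lemma A_perp:
  assumes "\<And>w. w \<in> W \<Longrightarrow> g u w = 0" "\<And>w. w \<in> W \<Longrightarrow> g v w = 0"
  shows "A u v = 0"
proof (rule A_eq_0_of_diagonal)
  let ?U = "{u. \<forall>w\<in>W. g u w = 0}"
  show "subspace ?U" by (auto simp: subspace_def)
  show "J u \<in> ?U" if "u \<in> ?U" for u using that J_W by (auto simp: g_J_left)
  show "A u u = 0" if "u \<in> ?U" for u
  proof -
    have u: "g u w = 0" if "w \<in> W" for w using \<open>u \<in> ?U\<close> that by blast
    \<comment> \<open>For \<open>u\<close> orthogonal to \<open>W\<close> only |A u u|^2 survives in
      the curvature identity.\<close>
    have "g (A (A u u) u) u = 0" using u[OF A_W] g_sym by metis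
    then show ?thesis using hsc_0[of u] A_adj_orthogonal_W[OF u, of u] by simp
  qed
qed (use assms in auto)

text \<open>This is \<open>normal_on\<close> for F = W; the summand \<open>A_adj w u\<close> drops
  out because \<open>u\<close> is orthogonal to \<open>W\<close>.\<close>

lemma normal_on_W:
  assumes u: "\<And>w. w \<in> W \<Longrightarrow> g u w = 0" and w: "w \<in> W"
  shows "A w u = 0" "A_adj u w \<in> W" "g (A_adj u w) (A_adj u w) = g (A u w) (A u w)"
  using normal_on[OF subspace_W J_W A_W_W A_W A_W A_W u w] A_adj_orthogonal_W[OF u, of w]
  by simp_all

lemma decompose:
  obtains p u where "x = p + u" "p \<in> W" "\<And>w. w \<in> W \<Longrightarrow> g u w = 0"
proof -
  obtain p where "p \<in> W" "\<And>w. w \<in> W \<Longrightarrow> g (x - p) w = 0"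
    using orthogonal_decomposition[OF subspace_W] by blast
  then show ?thesis using that[of p "x - p"] by simp
qed

lemma A_W_left:
  assumes "w \<in> W"
  shows "A w y = 0"
proof -
  obtain p u where "y = p + u" "p \<in> W" "\<And>w. w \<in> W \<Longrightarrow> g u w = 0"
    using decompose[of y] by metis
  then show ?thesis using A_W_W[OF assms] normal_on_W(1)[OF _ assms] by simp
qed

lemma A_adj_W_left: "w \<in> W \<Longrightarrow> A_adj w y = 0"
  by (rule g_eqI) (simp add: A_adj_left A_W_left)

lemma A_adj_W_normal:
  assumes w: "w \<in> W"
  shows "A_adj x w \<in> W" "g (A_adj x w) (A_adj x w) = g (A x w) (A x w)"
proof -
  obtain p u where pu: "x = p + u" "p \<in> W" "\<And>w. w \<in> W \<Longrightarrow> g u w = 0"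
    using decompose[of x] by metis
  then have "A x w = A u w" "A_adj x w = A_adj u w" using A_W_left A_adj_W_left by simp_all
  then show "A_adj x w \<in> W" "g (A_adj x w) (A_adj x w) = g (A x w) (A x w)"
    using normal_on_W[OF pu(3) w] by simp_all
qed

text \<open>The equality of norms polarises to one of inner products; tested against the commutator
  value \<open>d\<close>, which lies in \<open>W\<close>, it gives |d|^2 = 0.\<close>

lemma A_A_adj_commute_same:
  assumes w: "w \<in> W"
  shows "A x (A_adj x w) = A_adj x (A x w)"
proof -
  define d where "d = A x (A_adj x w) - A_adj x (A x w)"
  have d: "d \<in> W" unfolding d_def using A_W A_adj_W_normal(1) by (intro subspace_diff subspace_W) auto
  have "g (A_adj x (w + d)) (A_adj x (w + d)) = g (A x (w + d)) (A x (w + d))"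
    by (intro A_adj_W_normal(2) subspace_add subspace_W w d)
  then have "g (A_adj x w) (A_adj x d) = g (A x w) (A x d)"
    using A_adj_W_normal(2)[OF w, of x] A_adj_W_normal(2)[OF d, of x]
      g_sym[of "A_adj x d" "A_adj x w"] g_sym[of "A x d" "A x w"] by simp
  then have "g d d = 0" by (subst (1) d_def) (simp add: A_left A_adj_left del: g_eq_0)
  then have "d = 0" using g_eq_0 by blast
  then show ?thesis by (simp add: d_def)
qed

text \<open>Polarisation at \<open>x + y\<close> and \<open>x + J y\<close>: in its index
  \<open>A\<close> is conjugate linear and \<open>A_adj\<close> is linear, which separates the mixed
  terms.\<close>

lemma A_A_adj_commute:
  assumes w: "w \<in> W"
  shows "A x (A_adj y w) = A_adj y (A x w)"
proof -
  have "A (x + y) (A_adj (x + y) w) = A_adj (x + y) (A (x + y) w)"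
    "A (x + J y) (A_adj (x + J y) w) = A_adj (x + J y) (A (x + J y) w)"
    by (rule A_A_adj_commute_same[OF w])+
  then have 1: "A x (A_adj y w) + A y (A_adj x w) = A_adj x (A y w) + A_adj y (A x w)"
    and 2: "J (A x (A_adj y w) - A y (A_adj x w)) = J (A_adj y (A x w) - A_adj x (A y w))"
    using A_A_adj_commute_same[OF w, of x] A_A_adj_commute_same[OF w, of y] by (simp_all add: algebra_simps)
  have "A x (A_adj y w) - A y (A_adj x w) = A_adj y (A x w) - A_adj x (A y w)"
    using arg_cong[OF 2, of J] by (simp only: JJ neg_equal_iff_equal)
  with 1 have "(A x (A_adj y w) + A y (A_adj x w)) + (A x (A_adj y w) - A y (A_adj x w))
      = (A_adj x (A y w) + A_adj y (A x w)) + (A_adj y (A x w) - A_adj x (A y w))" by (simp only:)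
  then show ?thesis by (simp add: scaleR_2[symmetric])
qed

text \<open>The right-hand side of \<open>A_A_commutator\<close> is \<open>A\<close> of an element
  of \<open>W\<close>, hence zero.\<close>

lemma A_commute: "A x (A y z) = A y (A x z)"
proof -
  have "br x y - br (J x) (J y) \<in> W" by (intro subspace_diff subspace_W br_W)
  then have "A x (A y z) - A y (A x z) = 0" using A_A_commutator[of x y z] A_W_left by (simp only:)
  then show ?thesis by simp
qed

lemma A_adj_commute: "A_adj x (A_adj y z) = A_adj y (A_adj x z)"
  by (rule g_eqI) (simp add: A_adj_left A_commute[of y x])

text \<open>\<open>D x\<close> kills the complement of \<open>W\<close>; on \<open>W\<close> the
  operators \<open>A\<close> and \<open>A_adj\<close> all commute.\<close>

lemma D_commute: "D x (D y z) = D y (D x z)"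
proof -
  obtain p u where pu: "z = p + u" "p \<in> W" "\<And>w. w \<in> W \<Longrightarrow> g u w = 0"
    using decompose[of z] by metis
  have "D x u = 0" for x
  proof -
    obtain q v where qv: "x = q + v" "q \<in> W" "\<And>w. w \<in> W \<Longrightarrow> g v w = 0"
      using decompose[of x] by metis
    have "A x u = 0" using A_W_left[OF qv(2)] A_perp[OF qv(3) pu(3)] qv(1) by simp
    then show "D x u = 0" using A_adj_orthogonal_W[OF pu(3)] by (simp add: D_eq)
  qed
  moreover have "D x (D y p) = D y (D x p)"
  proof -
    have eq: "D a (D b p) = (1/4) *\<^sub>R (A a (A b p) - A a (A_adj b p) - A_adj a (A b p) + A_adj a (A_adj b p))"
      for a b
      by (subst (1 2) D_eq) (simp add: scaleR_right_diff_distrib scaleR_right_distrib)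
    show ?thesis
      unfolding eq A_A_adj_commute[OF pu(2)] A_commute[of x y] A_adj_commute[of x y]
      by (simp add: algebra_simps)
  qed
  ultimately show ?thesis by (simp add: pu(1))
qed

text \<open>The covariant derivatives commute, and \<open>D (br x y)\<close> vanishes because
  \<open>br x y\<close> is in \<open>W\<close>.\<close>

lemma flat: "curvature br g D x y z w = 0"
  using D_commute[of x y z] A_W_left[OF br_W] A_adj_W_left[OF br_W]
  by (simp add: curvature_def D_eq[of "br x y"])

end

context constant_hsc_lie_alg
begin

lemma chern_flat: "curvature br g D x y z w = 0"
proof (cases "W = {0}")
  case True
  \<comment> \<open>The abelian case stands apart because on the zero algebra \<open>c\<close> is
    arbitrary.\<close>
  then have "A x y = 0" for x y using A_W by blast
  moreover from this have "A_adj x y = 0" for x y by (intro g_eqI) (simp add: A_adj_left)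
  ultimately show ?thesis by (simp add: curvature_def D_eq)
next
  case False
  then have "zero_hsc_lie_alg br g J D"
    using c_eq_0 constant_hsc_lie_alg_axioms by (simp add: zero_hsc_lie_alg_def)
  then show ?thesis by (rule zero_hsc_lie_alg.flat)
qed

end

theorem mainTheorem2:
  fixes br :: "'a::euclidean_space \<Rightarrow> 'a \<Rightarrow> 'a"
    and J :: "'a \<Rightarrow> 'a"
    and g :: "'a \<Rightarrow> 'a \<Rightarrow> real"
    and D :: "'a \<Rightarrow> 'a \<Rightarrow> 'a"
  assumes "lie_bracket br"
    and "solvable_lie br"
    and "hermitian_structure br J g"
    and "J ` commutator br UNIV UNIV = commutator br UNIV UNIV"
    and "chern_connection br J g D"
    and "\<exists>c. \<forall>x. x \<noteq> 0 \<longrightarrow> holomorphic_sectional_curvature br J g D x = c"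
  shows "\<forall>x y z w. curvature br g D x y z w = 0"
proof -
  obtain c where "\<And>x. x \<noteq> 0 \<Longrightarrow> holomorphic_sectional_curvature br J g D x = c"
    using assms(6) by blast
  moreover have "inner_product g" using assms(3) by (simp add: hermitian_structure_def)
  ultimately interpret constant_hsc_lie_alg br g J D c
    using assms by unfold_locales auto
  show ?thesis using chern_flat by blast
qed

end
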